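(* Let $A$ be a bounded self-adjoint positive operator in a real Hilbert space $\mathcal{H}$ with $m=\inf_{\|x\|=1}(Ax,x)$, $M=\sup_{\|x\|=1}(Ax,x)$, $0<m<M<\infty$, and let $\rho=M/m$. Apply a $P$-gradient algorithm for the minimisation of $f(x)=\frac12(Ax,x)-(x,y)$, initialized at $x_0$ such that $z_0=z(x_0)$ satisfies, for any $\epsilon$ with $0<\epsilon<(M-m)/2$, $(E_{m+\epsilon}z_0,z_0)>0$ and $(E_{M-\epsilon}z_0,z_0)<1$, with $(E_\lambda)$ the spectral family of $A$. Let $p\in(0,1)$ be the number defining the attractor (see context). Then, for any bounded positive self-adjoint operator $W$ in $\mathcal{H}$ commuting with $A$, with bounds $c,C$ such that $0<c<C<\infty$ (i.e. $c=\inf_{\|x\|=1}(Wx,x)$, $C=\sup_{\|x\|=1}(Wx,x)$), $$\lim_{n\to\infty}\left[\prod_{k=0}^{n-1}\frac{(Wg_{k+1},g_{k+1})}{(Wg_k,g_k)}\right]^{1/n}=r(p)=\frac{p(1-p)(\rho-1)^2}{[p+\rho(1-p)][(1-p)+\rho p]}.$$ The function $r(\cdot)$ is symmetric with respect to $1/2$ and increasing on $[0,1/2]$, so that the worst asymptotic rate is obtained at $p=1/2$: $$R_{\max}=r(1/2)=\left(\frac{\rho-1}{\rho+1}\right)^2.$$ Moreover $r_k=\dfrac{(P(A)g_{k+1},g_{k+1})}{(P(A)g_k,g_k)}\leq R_{\max}$ for all $k$.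
   Context: $(\cdot,\cdot)$ is the inner product of $\mathcal{H}$ and $\|\cdot\|$ its norm. The gradient is $g(x)=Ax-y$, $g_k=g(x_k)$. $E_\lambda$ is the spectral projection of $A$ for $(-\infty,\lambda]$. Let $P(\cdot)$ be a real function on $[m,M]$, infinitely differentiable, with Laurent series $P(z)=\sum_{k=-\infty}^{\infty}c_kz^k$, $c_k\in\mathbb{R}$, such that $0<\sum_{k=-\infty}^\infty c_ka^k<\infty$ for all $a\in[m,M]$. The corresponding $P$-gradient algorithm is $x_{k+1}=x_k-\gamma_kg_k$, where the step-length $\gamma_k$ minimizes $(P(A)g(x_k-\gamma g_k),g(x_k-\gamma g_k))$ with respect to $\gamma$, that is $\gamma_k=(P(A)Ag_k,g_k)/(P(A)A^2g_k,g_k)$. The renormalised gradient is $z(x)=Bg(x)/(P(A)Ag(x),g(x))^{1/2}$, with $B=[P(A)A]^{1/2}$ the positive square root of $P(A)A$; $z_k=z(x_k)$. (Under the condition on $z_0$, $g_k\neq0$ for all $k$.) The number $p\in(0,1)$ defining the attractor is the number, depending on $z_0$, such that $z_{2k}=\sqrt{p}\,u_{2k}+\sqrt{1-p}\,v_{2k}$ and $z_{2k+1}=\sqrt{1-p}\,u_{2k+1}-\sqrt{p}\,v_{2k+1}$ for all $k$, for some vectors with $\|u_n\|=\|v_n\|=1$ for all $n$ and $\|Au_n-mu_n\|\to0$, $\|Av_n-Mv_n\|\to0$ as $n\to\infty$; such a $p$ exists under the stated condition on $z_0$. *)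

theory Defs
  imports "HOL-Analysis.Analysis"
begin

text \<open>A real Hilbert space is a type of sort \<open>{real_inner, banach}\<close>; operators are plain functions.\<close>

definition self_adjoint_op :: "('a::{real_inner, banach} \<Rightarrow> 'a) \<Rightarrow> bool" where
  "self_adjoint_op T \<longleftrightarrow> bounded_linear T \<and> (\<forall>x y. T x \<bullet> y = x \<bullet> T y)"

definition positive_op :: "('a::{real_inner, banach} \<Rightarrow> 'a) \<Rightarrow> bool" where
  "positive_op T \<longleftrightarrow> self_adjoint_op T \<and> (\<forall>x. 0 \<le> T x \<bullet> x)"

definition inf_bound :: "('a::{real_inner, banach} \<Rightarrow> 'a) \<Rightarrow> real" where
  "inf_bound T = (INF x\<in>{x. norm x = 1}. T x \<bullet> x)"

definition sup_bound :: "('a::{real_inner, banach} \<Rightarrow> 'a) \<Rightarrow> real" where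
  "sup_bound T = (SUP x\<in>{x. norm x = 1}. T x \<bullet> x)"

definition positive_sqrt_of :: "('a::{real_inner, banach} \<Rightarrow> 'a) \<Rightarrow> ('a \<Rightarrow> 'a) \<Rightarrow> bool" where
  "positive_sqrt_of B T \<longleftrightarrow> positive_op B \<and> B \<circ> B = T"

text \<open>
  \<open>E\<close> is the (right-continuous) spectral family of the bounded self-adjoint operator \<open>A\<close>:
  an increasing family of orthogonal projections running from \<open>0\<close> to the identity, with
  \<open>A = \<integral> t dE\<^sub>t\<close>, i.e. \<open>(A x, x) = \<integral> t d(E\<^sub>t x, x)\<close> for all \<open>x\<close>, a Lebesgue-Stieltjes
  integral. By the spectral theorem and polarization these properties determine \<open>E\<close> uniquely;
  \<open>E\<^sub>t\<close> is the spectral projection of \<open>A\<close> for \<open>(-\<infinity>, t]\<close>.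
\<close>
definition spectral_family_of ::
  "(real \<Rightarrow> 'a \<Rightarrow> 'a) \<Rightarrow> ('a::{real_inner, banach} \<Rightarrow> 'a) \<Rightarrow> bool" where
  "spectral_family_of E A \<longleftrightarrow>
     (\<forall>t. self_adjoint_op (E t) \<and> E t \<circ> E t = E t) \<and>
     (\<forall>s t. s \<le> t \<longrightarrow> E s \<circ> E t = E s) \<and>
     (\<forall>t x. ((\<lambda>s. E s x) \<longlongrightarrow> E t x) (at_right t)) \<and>
     (\<forall>x. ((\<lambda>s. E s x) \<longlongrightarrow> 0) at_bot) \<and>
     (\<forall>x. ((\<lambda>s. E s x) \<longlongrightarrow> x) at_top) \<and>
     (\<forall>x. integrable (interval_measure (\<lambda>t. E t x \<bullet> x)) (\<lambda>t. t) \<and>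
          A x \<bullet> x = (LINT t|interval_measure (\<lambda>t. E t x \<bullet> x). t))"

text \<open>Derivatives are relative to \<open>S\<close>, hence one-sided at the end points of an interval.\<close>

definition infinitely_differentiable_on :: "(real \<Rightarrow> real) \<Rightarrow> real set \<Rightarrow> bool" where
  "infinitely_differentiable_on P S \<longleftrightarrow>
     (\<exists>D :: nat \<Rightarrow> real \<Rightarrow> real. (\<forall>a\<in>S. D 0 a = P a) \<and>
        (\<forall>n. \<forall>a\<in>S. (D n has_real_derivative D (Suc n) a) (at a within S)))"

text \<open>
  The two-sided series converges when its part with nonnegative exponents and its part with
  negative exponents both do.
\<close>

definition laurent_series_on :: "(real \<Rightarrow> real) \<Rightarrow> (int \<Rightarrow> real) \<Rightarrow> real set \<Rightarrow> bool" where
  "laurent_series_on P c S \<longleftrightarrow>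
     (\<forall>a\<in>S. summable (\<lambda>k. c (int k) * a powi int k) \<and>
            summable (\<lambda>k. c (- int (Suc k)) * a powi (- int (Suc k))) \<and>
            P a = (\<Sum>k. c (int k) * a powi int k)
                + (\<Sum>k. c (- int (Suc k)) * a powi (- int (Suc k))))"

text \<open>
  \<open>P(A) = \<Sum>\<^sub>k c\<^sub>k A\<^sup>k\<close>. If the scalar series converges on \<open>[m, M]\<close>, \<open>0 < m\<close>, it converges
  uniformly there (Abel), so the operator series below converges (even in operator norm).
\<close>

definition laurent_op ::
  "(int \<Rightarrow> real) \<Rightarrow> ('a::{real_inner, banach} \<Rightarrow> 'a) \<Rightarrow> 'a \<Rightarrow> 'a" where
  "laurent_op c A x = (\<Sum>k. c (int k) *\<^sub>R (A ^^ k) x)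
                    + (\<Sum>k. c (- int (Suc k)) *\<^sub>R (inv A ^^ Suc k) x)"

definition objective :: "('a::{real_inner, banach} \<Rightarrow> 'a) \<Rightarrow> 'a \<Rightarrow> 'a \<Rightarrow> real" where
  "objective A y x = (A x \<bullet> x) / 2 - x \<bullet> y"

definition grad :: "('a::{real_inner, banach} \<Rightarrow> 'a) \<Rightarrow> 'a \<Rightarrow> 'a \<Rightarrow> 'a" where
  "grad A y x = A x - y"

lemma grad_is_gradient_of_objective:
  assumes "self_adjoint_op A"
  shows "(objective A y has_derivative (\<lambda>h. grad A y x \<bullet> h)) (at x)"
proof -
  have bl: "bounded_linear A" and sa: "\<And>u v. A u \<bullet> v = u \<bullet> A v"
    using assms by (auto simp: self_adjoint_op_def)
  have "((\<lambda>x. (A x \<bullet> x) / 2 - x \<bullet> y) has_derivative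
         (\<lambda>h. (A x \<bullet> h + A h \<bullet> x) / 2 - h \<bullet> y)) (at x)"
    by (auto intro!: derivative_eq_intros bounded_linear_imp_has_derivative bl)
  moreover have "(\<lambda>h. (A x \<bullet> h + A h \<bullet> x) / 2 - h \<bullet> y) = (\<lambda>h. grad A y x \<bullet> h)"
    using sa by (simp add: grad_def inner_diff_left inner_commute[of _ y] inner_commute[of x] fun_eq_iff)
  ultimately show ?thesis
    by (simp add: objective_def[abs_def])
qed

text \<open>\<open>PA\<close> stands for the operator \<open>P(A)\<close>; the step-length minimizes over all real \<open>s\<close>.\<close>

definition P_gradient_algorithm ::
  "('a::{real_inner, banach} \<Rightarrow> 'a) \<Rightarrow> ('a \<Rightarrow> 'a) \<Rightarrow> 'a \<Rightarrow> (nat \<Rightarrow> 'a) \<Rightarrow> (nat \<Rightarrow> real) \<Rightarrow> bool" where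
  "P_gradient_algorithm A PA y x \<gamma> \<longleftrightarrow>
     (\<forall>k. x (Suc k) = x k - \<gamma> k *\<^sub>R grad A y (x k) \<and>
          is_arg_min (\<lambda>s. PA (grad A y (x k - s *\<^sub>R grad A y (x k)))
                            \<bullet> grad A y (x k - s *\<^sub>R grad A y (x k)))
                     (\<lambda>_. True) (\<gamma> k))"

definition renormalised_grad ::
  "('a::{real_inner, banach} \<Rightarrow> 'a) \<Rightarrow> ('a \<Rightarrow> 'a) \<Rightarrow> ('a \<Rightarrow> 'a) \<Rightarrow> 'a \<Rightarrow> 'a \<Rightarrow> 'a" where
  "renormalised_grad A PA B y x =
     B (grad A y x) /\<^sub>R sqrt (PA (A (grad A y x)) \<bullet> grad A y x)"

definition attractor_number ::
  "('a::{real_inner, banach} \<Rightarrow> 'a) \<Rightarrow> real \<Rightarrow> real \<Rightarrow> (nat \<Rightarrow> 'a) \<Rightarrow> real \<Rightarrow> bool" where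
  "attractor_number A m M z p \<longleftrightarrow>
     (\<exists>u v :: nat \<Rightarrow> 'a.
        (\<forall>n. norm (u n) = 1 \<and> norm (v n) = 1) \<and>
        (\<forall>k. z (2*k) = sqrt p *\<^sub>R u (2*k) + sqrt (1 - p) *\<^sub>R v (2*k) \<and>
             z (2*k+1) = sqrt (1 - p) *\<^sub>R u (2*k+1) - sqrt p *\<^sub>R v (2*k+1)) \<and>
        (\<lambda>n. norm (A (u n) - m *\<^sub>R u n)) \<longlonglongrightarrow> 0 \<and>
        (\<lambda>n. norm (A (v n) - M *\<^sub>R v n)) \<longlonglongrightarrow> 0)"

definition asymptotic_rate :: "real \<Rightarrow> real \<Rightarrow> real" where
  "asymptotic_rate \<rho> p =
     p * (1 - p) * (\<rho> - 1)^2 / ((p + \<rho> * (1 - p)) * ((1 - p) + \<rho> * p))"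

end

theory Submission
  imports Defs "HOL-Computational_Algebra.Fundamental_Theorem_Algebra"
begin

text \<open>
  For the renormalised gradient \<open>z = B g / (P(A) A g, g)\<^sup>1\<^sup>/\<^sup>2\<close>, which is a unit vector, minimality of
  the step gives \<open>r\<^sub>k = 1 - 1 / ((A z\<^sub>k, z\<^sub>k) (A\<^sup>-\<^sup>1 z\<^sub>k, z\<^sub>k))\<close>, because \<open>B\<close> commutes with \<open>A\<close>.
  Kantorovich's inequality bounds this by \<open>R\<^sub>m\<^sub>a\<^sub>x\<close>. On the attractor the vectors \<open>u\<^sub>n\<close> and \<open>v\<^sub>n\<close> are
  asymptotically orthogonal approximate eigenvectors of \<open>A\<close> and \<open>A\<^sup>-\<^sup>1\<close>, so \<open>r\<^sub>k \<longlonglongrightarrow> r(p)\<close>. As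
  \<open>(W g, g)\<close> and \<open>(P(A) g, g)\<close> are comparable up to constants, the geometric means of the \<open>W\<close>-rates
  have the same limit. The comparison needs \<open>P(A) \<ge> d > 0\<close>: Laurent sections converge
  uniformly (Abel), and a section whose numerical range had a too small infimum \<open>l\<close> would give a
  polynomial without roots in \<open>[m, M]\<close>, namely \<open>t\<^sup>n (P\<^sub>n(t) - l)\<close>, that is not bounded below at \<open>A\<close>.
\<close>

section \<open>Self-adjoint operators and Abel summation\<close>

lemma self_adjoint_opD:
  assumes "self_adjoint_op T"
  shows "bounded_linear T" and "T x \<bullet> y = x \<bullet> T y"
  using assms by (auto simp: self_adjoint_op_def)

lemma self_adjoint_op_ident [simp]: "self_adjoint_op (\<lambda>x. x)"
  by (simp add: self_adjoint_op_def bounded_linear_ident)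

lemma self_adjoint_op_scaleR: "self_adjoint_op T \<Longrightarrow> self_adjoint_op (\<lambda>x. a *\<^sub>R T x)"
  by (auto simp: self_adjoint_op_def intro: bounded_linear_intros)

lemma self_adjoint_op_add:
  "self_adjoint_op S \<Longrightarrow> self_adjoint_op T \<Longrightarrow> self_adjoint_op (\<lambda>x. S x + T x)"
  by (auto simp: self_adjoint_op_def bounded_linear_add inner_add_left inner_add_right)

lemma self_adjoint_op_diff:
  "self_adjoint_op S \<Longrightarrow> self_adjoint_op T \<Longrightarrow> self_adjoint_op (\<lambda>x. S x - T x)"
  by (auto simp: self_adjoint_op_def bounded_linear_sub inner_diff_left inner_diff_right)

lemma self_adjoint_op_sum:
  "(\<And>i. i \<in> I \<Longrightarrow> self_adjoint_op (T i)) \<Longrightarrow> self_adjoint_op (\<lambda>x. \<Sum>i\<in>I. T i x)"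
  by (auto simp: self_adjoint_op_def bounded_linear_sum inner_sum_left inner_sum_right
      intro!: sum.cong)

lemma bounded_linear_funpow:
  fixes T :: "'a::real_normed_vector \<Rightarrow> 'a"
  shows "bounded_linear T \<Longrightarrow> bounded_linear (T ^^ n)"
proof (induction n)
  case 0
  have "T ^^ 0 = (\<lambda>x. x)" by (simp add: fun_eq_iff)
  then show ?case by (simp only: bounded_linear_ident)
next
  case (Suc n)
  then show ?case
    using bounded_linear_compose[of T "T ^^ n"] by (simp add: o_def)
qed

lemma funpow_self_adjoint:
  assumes "self_adjoint_op T"
  shows "(T ^^ n) x \<bullet> y = x \<bullet> (T ^^ n) y"
proof (induction n arbitrary: y)
  case (Suc n)
  show ?case
    using self_adjoint_opD(2)[OF assms, of "(T ^^ n) x" y] Suc[of "T y"]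
    by (simp add: funpow_swap1[of T n y])
qed simp

lemma self_adjoint_op_funpow: "self_adjoint_op T \<Longrightarrow> self_adjoint_op (T ^^ n)"
  by (simp add: self_adjoint_op_def funpow_self_adjoint bounded_linear_funpow)

section \<open>Norm bounds from bounds on the quadratic form\<close>

lemma norm_le_if_numerical_radius_le:
  assumes T: "self_adjoint_op T" and le: "\<And>x. \<bar>T x \<bullet> x\<bar> \<le> b * (x \<bullet> x)"
  shows "norm (T x) \<le> b * norm x"
proof (cases "T x = 0")
  case True
  show ?thesis
  proof (cases "x = 0")
    case False
    then have "0 < x \<bullet> x" by simp
    moreover have "0 \<le> b * (x \<bullet> x)" using le[of x] by linarith
    ultimately have "0 \<le> b" by (simp add: zero_le_mult_iff not_le[symmetric])
    then show ?thesis by (simp add: True)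
  qed (use self_adjoint_opD(1)[OF T] in \<open>simp add: bounded_linear.linear linear_0\<close>)
next
  case False
  interpret bounded_linear T using T by (rule self_adjoint_opD)
  have x0: "x \<noteq> 0" using False zero by auto
  \<comment> \<open>\<open>y\<close> is \<open>T x\<close> rescaled to the length of
    \<open>x\<close>. Polarization bounds \<open>(T x, y)\<close> through the form at
    \<open>x + y\<close> and \<open>x - y\<close>, and the parallelogram law adds up the two
    bounds.\<close>
  define y where "y = (norm x / norm (T x)) *\<^sub>R T x"
  have ny: "norm y = norm x" using False by (simp add: y_def)
  have Txy: "T x \<bullet> y = norm x * norm (T x)"
    using False by (simp add: y_def power2_norm_eq_inner[symmetric] power2_eq_square)
  have "4 * (T x \<bullet> y) = T (x + y) \<bullet> (x + y) - T (x - y) \<bullet> (x - y)"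
    using self_adjoint_opD(2)[OF T, of x y]
    by (simp add: add diff inner_simps inner_commute)
  also have "\<dots> \<le> b * ((x + y) \<bullet> (x + y)) + b * ((x - y) \<bullet> (x - y))"
    using le[of "x + y"] le[of "x - y"] by linarith
  also have "\<dots> = b * (2 * (x \<bullet> x) + 2 * (y \<bullet> y))"
    by (simp add: inner_simps inner_commute algebra_simps)
  also have "\<dots> = 4 * (b * (norm x * norm x))"
    by (simp add: power2_norm_eq_inner[symmetric] ny power2_eq_square)
  finally have "norm x * norm (T x) \<le> norm x * (b * norm x)"
    using Txy by (simp add: algebra_simps)
  then show ?thesis using x0 by simp
qed

text \<open>Nonnegativity of the form at \<open>b *\<^sub>R x - T x\<close>, combined with the upper
  bound at \<open>T x\<close>. In operator terms, \<open>0 \<le> T \<le> b\<close> gives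
  \<open>T^2 \<le> b T\<close>.\<close>

lemma inner_self_le_if_le:
  assumes T: "self_adjoint_op T" and nonneg: "\<And>x. 0 \<le> T x \<bullet> x"
    and le: "\<And>x. T x \<bullet> x \<le> b * (x \<bullet> x)" and b: "0 < b"
  shows "T x \<bullet> T x \<le> b * (T x \<bullet> x)"
proof -
  interpret bounded_linear T using T by (rule self_adjoint_opD)
  have "0 \<le> T (b *\<^sub>R x - T x) \<bullet> (b *\<^sub>R x - T x)"
    by (rule nonneg)
  also have "\<dots> = b^2 * (T x \<bullet> x) - 2 * b * (T x \<bullet> T x) + T (T x) \<bullet> T x"
    using self_adjoint_opD(2)[OF T, of "T x" x]
    by (simp add: diff scaleR inner_simps algebra_simps power2_eq_square inner_commute)
  also have "\<dots> \<le> b^2 * (T x \<bullet> x) - 2 * b * (T x \<bullet> T x) + b * (T x \<bullet> T x)"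
    using le[of "T x"] by simp
  finally have "0 \<le> b * (b * (T x \<bullet> x) - T x \<bullet> T x)"
    by (simp add: algebra_simps power2_eq_square)
  then show ?thesis using b by (simp add: zero_le_mult_iff)
qed

text \<open>The exponent is split in halves: an even power yields the squared norm of
  \<open>(S ^^ j) x\<close>, an odd one the form of \<open>S\<close> at that vector. Then
  \<open>S \<le> 1\<close> and \<open>S^2 \<le> S\<close> compare neighbouring powers.\<close>

lemma funpow_decreasing:
  assumes S: "self_adjoint_op S" and nonneg: "\<And>x. 0 \<le> S x \<bullet> x" and le: "\<And>x. S x \<bullet> x \<le> x \<bullet> x"
  shows "0 \<le> (S ^^ n) x \<bullet> x" and "(S ^^ Suc n) x \<bullet> x \<le> (S ^^ n) x \<bullet> x"
proof -
  have half: "(S ^^ (j + k)) x \<bullet> x = (S ^^ k) x \<bullet> (S ^^ j) x" for j k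
    by (simp add: funpow_add funpow_self_adjoint[OF S])
  have "\<exists>j. n = j + j \<or> n = j + Suc j"
    by presburger
  then obtain j where "n = j + j \<or> n = j + Suc j" ..
  then have "0 \<le> (S ^^ n) x \<bullet> x \<and> (S ^^ Suc n) x \<bullet> x \<le> (S ^^ n) x \<bullet> x"
  proof
    assume n: "n = j + j"
    then have "Suc n = j + Suc j" by simp
    then show ?thesis
      using n half[of j j] half[of j "Suc j"] le[of "(S ^^ j) x"] by simp
  next
    assume n: "n = j + Suc j"
    then have "Suc n = Suc j + Suc j" by simp
    then show ?thesis
      using n half[of j "Suc j"] half[of "Suc j" "Suc j"] nonneg[of "(S ^^ j) x"]
        inner_self_le_if_le[of S 1 "(S ^^ j) x"] S nonneg le by simp
  qed
  then show "0 \<le> (S ^^ n) x \<bullet> x" and "(S ^^ Suc n) x \<bullet> x \<le> (S ^^ n) x \<bullet> x"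
    by blast+
qed

text \<open>Summation by parts: the numbers \<open>(S^i x, x)\<close> are nonnegative and decreasing
  in \<open>i\<close>, so the bound \<open>e\<close> on the partial sums of \<open>a\<close> carries
  over to the form, the differences telescoping. Self-adjointness turns this into a norm
  bound.\<close>

lemma norm_sum_funpow_le:
  fixes S :: "'a::{real_inner, banach} \<Rightarrow> 'a"
  assumes S: "self_adjoint_op S" and nonneg: "\<And>x. 0 \<le> S x \<bullet> x" and le: "\<And>x. S x \<bullet> x \<le> x \<bullet> x"
    and e: "\<And>k. \<bar>\<Sum>i<k. a i\<bar> \<le> e"
  shows "norm (\<Sum>i<k. a i *\<^sub>R (S ^^ i) x) \<le> e * norm x"
proof (rule norm_le_if_numerical_radius_le)
  show "self_adjoint_op (\<lambda>x. \<Sum>i<k. a i *\<^sub>R (S ^^ i) x)"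
    by (intro self_adjoint_op_sum self_adjoint_op_scaleR self_adjoint_op_funpow S)
next
  fix x
  define s where "s i = (S ^^ i) x \<bullet> x" for i
  have s: "0 \<le> s i" "s (Suc i) \<le> s i" for i
    unfolding s_def by (rule funpow_decreasing[OF S nonneg le])+
  have by_parts: "(\<Sum>i<k. a i * s i)
      = (\<Sum>i<k. a i) * s k + (\<Sum>i<k. (\<Sum>j<Suc i. a j) * (s i - s (Suc i)))"
    by (induction k) (simp_all add: algebra_simps)
  have "\<bar>\<Sum>i<k. a i * s i\<bar> \<le> e * s k + (\<Sum>i<k. e * (s i - s (Suc i)))"
    unfolding by_parts
  proof (rule order_trans[OF abs_triangle_ineq], rule add_mono)
    show "\<bar>(\<Sum>i<k. a i) * s k\<bar> \<le> e * s k"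
      using e s by (simp add: abs_mult mult_right_mono)
    show "\<bar>\<Sum>i<k. (\<Sum>j<Suc i. a j) * (s i - s (Suc i))\<bar> \<le> (\<Sum>i<k. e * (s i - s (Suc i)))"
      by (rule order_trans[OF sum_abs], rule sum_mono, subst abs_mult)
        (use e s in \<open>simp add: mult_right_mono del: sum.lessThan_Suc\<close>)
  qed
  also have "\<dots> = e * s 0"
  proof -
    have "(\<Sum>i<k. s i - s (Suc i)) = s 0 - s k"
      by (induction k) simp_all
    then have "(\<Sum>i<k. e * (s i - s (Suc i))) = e * (s 0 - s k)"
      by (simp only: sum_distrib_left[symmetric])
    then show ?thesis by (simp add: right_diff_distrib)
  qed
  finally show "\<bar>(\<Sum>i<k. a i *\<^sub>R (S ^^ i) x) \<bullet> x\<bar> \<le> e * (x \<bullet> x)"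
    by (simp add: s_def inner_sum_left)
qed

text \<open>
  Abel's theorem up to the boundary, uniformly in the operator: the rank \<open>N\<close> depends on the
  coefficients only, so that scalars and operators can be treated alike.
\<close>

lemma summable_Abel_rank:
  fixes a :: "nat \<Rightarrow> real"
  assumes "summable a" "0 < e"
  shows "\<exists>N. \<forall>n\<ge>N. \<forall>k. \<bar>\<Sum>i<k. a (n + i)\<bar> \<le> e"
proof -
  obtain N where N: "\<And>m n. N \<le> m \<Longrightarrow> norm (sum a {m..<n}) < e"
    using assms unfolding summable_Cauchy by blast
  have "\<bar>\<Sum>i<k. a (n + i)\<bar> \<le> e" if "N \<le> n" for n k
  proof -
    have "(\<Sum>i<k. a (n + i)) = sum a {n..<n + k}"
      by (simp add: sum.atLeastLessThan_shift_0[of a n "n + k"] lessThan_atLeast0)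
    then show ?thesis using N[OF that, of "n + k"] by simp
  qed
  then show ?thesis by blast
qed

lemma Abel_operator_series:
  fixes S :: "'a::{real_inner, banach} \<Rightarrow> 'a"
  assumes S: "self_adjoint_op S" and nonneg: "\<And>x. 0 \<le> S x \<bullet> x" and le: "\<And>x. S x \<bullet> x \<le> x \<bullet> x"
    and a: "summable a"
  shows "summable (\<lambda>i. a i *\<^sub>R (S ^^ i) x)"
    and "\<lbrakk>\<And>n k. N \<le> n \<Longrightarrow> \<bar>\<Sum>i<k. a (n + i)\<bar> \<le> e; N \<le> n\<rbrakk>
      \<Longrightarrow> norm ((\<Sum>i. a i *\<^sub>R (S ^^ i) x) - (\<Sum>i<n. a i *\<^sub>R (S ^^ i) x)) \<le> e * norm x"
proof -
  have contr: "norm ((S ^^ n) x) \<le> norm x" for n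
  proof (induction n)
    case (Suc n)
    have "norm (S ((S ^^ n) x)) \<le> 1 * norm ((S ^^ n) x)"
      by (rule norm_le_if_numerical_radius_le[OF S]) (use nonneg le in simp)
    with Suc show ?case by simp
  qed simp
  \<comment> \<open>A block starting at \<open>n\<close> is a polynomial in \<open>S\<close> with
    shifted coefficients, applied to \<open>(S ^^ n) x\<close>, which is no longer than
    \<open>x\<close>.\<close>
  have tail: "norm (\<Sum>i<k. a (n + i) *\<^sub>R (S ^^ (n + i)) x) \<le> e * norm x"
    if "\<And>k. \<bar>\<Sum>i<k. a (n + i)\<bar> \<le> e" for e n k
  proof -
    have e0: "0 \<le> e" using that[of 0] by simp
    have "norm (\<Sum>i<k. a (n + i) *\<^sub>R (S ^^ i) ((S ^^ n) x)) \<le> e * norm ((S ^^ n) x)"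
      by (rule norm_sum_funpow_le[OF S nonneg le that])
    also have "\<dots> \<le> e * norm x"
      using contr e0 by (rule mult_left_mono)
    finally show ?thesis
      by (simp add: add.commute[of n] funpow_add)
  qed
  let ?f = "\<lambda>i. a i *\<^sub>R (S ^^ i) x"
  have shift: "sum ?f {n..<n + k} = (\<Sum>i<k. ?f (n + i))" for n k
    by (simp add: sum.atLeastLessThan_shift_0[of ?f n "n + k"] lessThan_atLeast0)
  show sm: "summable ?f"
    unfolding summable_Cauchy
  proof (intro allI impI)
    fix e :: real assume e: "0 < e"
    \<comment> \<open>The summand 1 keeps the denominator nonzero for \<open>x = 0\<close> and makes
      the final inequality strict.\<close>
    define d where "d = e / (norm x + 1)"
    have d: "0 < d" using e by (simp add: d_def add_nonneg_pos)
    have "d * norm x < d * (norm x + 1)" using d by simp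
    also have "\<dots> = e"
      by (simp add: d_def) (metis add_nonneg_pos less_irrefl norm_ge_zero zero_less_one)
    finally have de: "d * norm x < e" .
    obtain N where N: "\<And>n k. N \<le> n \<Longrightarrow> \<bar>\<Sum>i<k. a (n + i)\<bar> \<le> d"
      using summable_Abel_rank[OF a d] by blast
    have "norm (sum ?f {m..<n}) < e" if "N \<le> m" for m n
    proof (cases "m \<le> n")
      case True
      then obtain k where k: "n = m + k" using le_Suc_ex by blast
      have "norm (sum ?f {m..<n}) \<le> d * norm x"
        using tail[of m d k] N[OF that] by (simp only: k shift)
      then show ?thesis using de by simp
    qed (use e in simp)
    then show "\<exists>N. \<forall>m\<ge>N. \<forall>n. norm (sum ?f {m..<n}) < e" by blast
  qed
  assume N: "\<And>n k. N \<le> n \<Longrightarrow> \<bar>\<Sum>i<k. a (n + i)\<bar> \<le> e" and n: "N \<le> n"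
  have "norm (\<Sum>i. ?f (i + n)) \<le> e * norm x"
  proof (rule Lim_bounded[where M = 0], rule tendsto_norm, rule summable_LIMSEQ)
    show "summable (\<lambda>i. ?f (i + n))" using sm by (rule summable_ignore_initial_segment)
    show "\<forall>k\<ge>0. norm (\<Sum>i<k. ?f (i + n)) \<le> e * norm x"
      using tail[of n e] N[OF n] by (simp add: add.commute)
  qed
  then show "norm ((\<Sum>i. ?f i) - (\<Sum>i<n. ?f i)) \<le> e * norm x"
    using suminf_minus_initial_segment[OF sm, of n] by simp
qed

section \<open>Numerical range and polynomials of an operator\<close>

lemma norm_ge_if_inner_ge:
  fixes w x :: "'a::real_inner"
  assumes "b * (x \<bullet> x) \<le> \<bar>w \<bullet> x\<bar>"
  shows "b * norm x \<le> norm w"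
proof (cases "x = 0")
  case False
  have "b * norm x * norm x \<le> norm w * norm x"
    using assms Cauchy_Schwarz_ineq2[of w x]
    by (simp add: power2_norm_eq_inner[symmetric] power2_eq_square mult.assoc)
  then show ?thesis using False by simp
qed simp

lemma bdd_inner_unit:
  fixes T :: "'a::{real_inner, banach} \<Rightarrow> 'a"
  assumes "bounded_linear T"
  shows "bdd_below ((\<lambda>x. T x \<bullet> x) ` {x. norm x = 1})"
    and "bdd_above ((\<lambda>x. T x \<bullet> x) ` {x. norm x = 1})"
proof -
  have "\<bar>T x \<bullet> x\<bar> \<le> onorm T" if "norm x = 1" for x
    using Cauchy_Schwarz_ineq2[of "T x" x] onorm[OF assms, of x] that by simp
  then show "bdd_below ((\<lambda>x. T x \<bullet> x) ` {x. norm x = 1})"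
    and "bdd_above ((\<lambda>x. T x \<bullet> x) ` {x. norm x = 1})"
    by (force intro!: bdd_belowI[of _ "- onorm T"] bdd_aboveI[of _ "onorm T"])+
qed

lemma inner_eq_unit_inner:
  fixes T :: "'a::{real_inner, banach} \<Rightarrow> 'a"
  assumes "bounded_linear T" "x \<noteq> 0"
  shows "T x \<bullet> x = (T (x /\<^sub>R norm x) \<bullet> (x /\<^sub>R norm x)) * (x \<bullet> x)"
  using assms
  by (simp add: linear_scale[OF bounded_linear.linear] power2_norm_eq_inner[symmetric] power2_eq_square
      field_simps)

lemma inf_bound_le_inner:
  assumes T: "bounded_linear T"
  shows "inf_bound T * (x \<bullet> x) \<le> T x \<bullet> x"
proof (cases "x = 0")
  case False
  have "inf_bound T \<le> T (x /\<^sub>R norm x) \<bullet> (x /\<^sub>R norm x)"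
    unfolding inf_bound_def by (rule cINF_lower[OF bdd_inner_unit(1)[OF T]]) (simp add: False)
  then show ?thesis
    by (subst inner_eq_unit_inner[OF T False]) (simp add: mult_right_mono)
qed simp

lemma inner_le_sup_bound:
  assumes T: "bounded_linear T"
  shows "T x \<bullet> x \<le> sup_bound T * (x \<bullet> x)"
proof (cases "x = 0")
  case False
  have "T (x /\<^sub>R norm x) \<bullet> (x /\<^sub>R norm x) \<le> sup_bound T"
    unfolding sup_bound_def by (rule cSUP_upper[OF _ bdd_inner_unit(2)[OF T]]) (simp add: False)
  then show ?thesis
    by (subst inner_eq_unit_inner[OF T False]) (simp add: mult_right_mono)
qed (use T in \<open>simp add: bounded_linear.linear linear_0\<close>)

text \<open>After subtracting the infimum \<open>l\<close>, the form of \<open>S = T - l\<close> is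
  nonnegative and gets arbitrarily small on unit vectors. Since
  \<open>norm (S x)^2 \<le> b (S x, x)\<close>, a unit vector with \<open>(S x, x) < c^2 / b\<close>
  has \<open>norm (S x) < c\<close>.\<close>

lemma inf_bound_approximate_eigenvalue:
  fixes T :: "'a::{real_inner, banach} \<Rightarrow> 'a"
  assumes T: "self_adjoint_op T" and e: "\<exists>x::'a. x \<noteq> 0" and c: "0 < c"
  shows "\<exists>x. norm x = 1 \<and> norm (T x - inf_bound T *\<^sub>R x) < c"
proof -
  let ?l = "inf_bound T"
  have bl: "bounded_linear T" using T by (rule self_adjoint_opD)
  define S where "S x = T x - ?l *\<^sub>R x" for x
  have S: "self_adjoint_op S"
    unfolding S_def by (intro self_adjoint_op_diff self_adjoint_op_scaleR self_adjoint_op_ident T)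
  have S0: "0 \<le> S x \<bullet> x" for x
    using inf_bound_le_inner[OF bl, of x] by (simp add: S_def inner_diff_left)
  define b where "b = \<bar>sup_bound S\<bar> + 1"
  have b: "0 < b" by (simp add: b_def add_nonneg_pos)
  have Sb: "S x \<bullet> x \<le> b * (x \<bullet> x)" for x
    by (rule order_trans[OF inner_le_sup_bound[OF self_adjoint_opD(1)[OF S]]])
      (auto simp: b_def intro: mult_right_mono)
  obtain w :: 'a where "w \<noteq> 0" using e by blast
  then have "{x::'a. norm x = 1} \<noteq> {}"
    by (auto intro: exI[of _ "w /\<^sub>R norm w"])
  moreover have "?l < ?l + c^2 / b" using b c by simp
  ultimately have "\<exists>x\<in>{x. norm x = 1}. T x \<bullet> x < ?l + c^2 / b"
    using cINF_less_iff[OF _ bdd_inner_unit(1)[OF bl], of "?l + c^2 / b"]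
    unfolding inf_bound_def by blast
  then obtain x where x: "norm x = 1" "T x \<bullet> x < ?l + c^2 / b" by blast
  then have xx: "x \<bullet> x = 1" by (simp add: norm_eq_1)
  have "(norm (S x))^2 \<le> b * (S x \<bullet> x)"
    using inner_self_le_if_le[OF S S0 Sb b] by (simp add: power2_norm_eq_inner)
  also have "S x \<bullet> x < c^2 / b"
    using x xx by (simp add: S_def inner_diff_left)
  then have "b * (S x \<bullet> x) < c^2"
    using b by (simp add: field_simps)
  finally have "norm (S x) < c"
    using c by (simp add: power_less_imp_less_base)
  then show ?thesis using x by (auto simp: S_def)
qed

text \<open>The operator \<open>p(A)\<close> in Horner form, so that the rule for
  \<open>pCons\<close> drives all inductions below.\<close>

definition poly_op :: "('a::real_vector \<Rightarrow> 'a) \<Rightarrow> real poly \<Rightarrow> 'a \<Rightarrow> 'a" where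
  "poly_op A p x = fold_coeffs (\<lambda>a w. a *\<^sub>R x + A w) p 0"

context
  fixes A :: "'a::real_vector \<Rightarrow> 'a"
  assumes A: "linear A"
begin

interpretation A: linear A by (rule A)

lemma poly_op_0 [simp]: "poly_op A 0 x = 0"
  by (simp add: poly_op_def)

lemma poly_op_pCons [simp]: "poly_op A (pCons a p) x = a *\<^sub>R x + A (poly_op A p x)"
  by (cases "p = 0 \<and> a = 0") (auto simp: poly_op_def A.zero)

lemma poly_op_add: "poly_op A (p + q) x = poly_op A p x + poly_op A q x"
  by (induction p q rule: poly_induct2) (simp_all add: A.add scaleR_add_left)

lemma poly_op_smult: "poly_op A (smult a p) x = a *\<^sub>R poly_op A p x"
  by (induction p) (simp_all add: A.scale scaleR_add_right A.zero)

lemma poly_op_sum: "poly_op A (\<Sum>i\<in>I. p i) x = (\<Sum>i\<in>I. poly_op A (p i) x)"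
  by (induction I rule: infinite_finite_induct) (simp_all add: poly_op_add)

lemma poly_op_monom: "poly_op A (monom a n) x = a *\<^sub>R (A ^^ n) x"
  by (induction n) (simp_all add: monom_0 monom_Suc A.scale A.zero)

lemma poly_op_mult: "poly_op A (p * q) x = poly_op A p (poly_op A q x)"
  by (induction p) (simp_all add: poly_op_add poly_op_smult)

end

section \<open>Factorization of real polynomials and lower bounds for \<open>p(A)\<close>\<close>

lemma poly_map_of_real_add:
  "poly (map_poly complex_of_real (p + q)) z
    = poly (map_poly complex_of_real p) z + poly (map_poly complex_of_real q) z"
  by (induction p q rule: poly_induct2) (simp_all add: map_poly_pCons algebra_simps)

lemma poly_map_of_real_mult:
  "poly (map_poly complex_of_real (p * q)) z
    = poly (map_poly complex_of_real p) z * poly (map_poly complex_of_real q) z"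
  by (induction p) (simp_all add: poly_map_of_real_add map_poly_smult map_poly_pCons algebra_simps)

text \<open>The fundamental theorem of algebra gives a complex root \<open>z = a + i b\<close>. A
  real root splits off a linear factor; otherwise the polynomial \<open>d\<close> with roots
  \<open>z\<close> and its conjugate divides \<open>h\<close>, because the remainder of degree at
  most 1 has real coefficients and vanishes at \<open>z\<close>.\<close>

lemma real_poly_linear_or_quadratic_factor:
  fixes h :: "real poly"
  assumes "degree h \<noteq> 0"
  shows "(\<exists>r. [:- r, 1:] dvd h) \<or> (\<exists>a b. b \<noteq> 0 \<and> [:a^2 + b^2, - 2 * a, 1:] dvd h)"
proof -
  let ?ev = "\<lambda>q z. poly (map_poly complex_of_real q) z"
  have "degree (map_poly complex_of_real h) = degree h"
    using assms by (intro map_poly_degree_eq) auto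
  then have "\<not> constant (poly (map_poly complex_of_real h))"
    using assms by (simp add: constant_degree)
  then obtain z where z: "?ev h z = 0"
    using fundamental_theorem_of_algebra by blast
  define a b where "a = Re z" and "b = Im z"
  show ?thesis
  proof (cases "b = 0")
    case True
    have "?ev q (complex_of_real a) = complex_of_real (poly q a)" for q
      by (induction q) (simp_all add: map_poly_pCons)
    moreover have "z = complex_of_real a" using True by (simp add: a_def b_def complex_eq_iff)
    ultimately have "poly h a = 0" using z by simp
    then show ?thesis by (auto simp: poly_eq_0_iff_dvd)
  next
    case False
    define d where "d = [:a^2 + b^2, - 2 * a, 1:]"
    have d0: "?ev d z = 0"
      by (simp add: d_def map_poly_pCons complex_eq_iff a_def b_def power2_eq_square algebra_simps)
    have "degree d = 2" "d \<noteq> 0" by (simp_all add: d_def)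
    then have "degree (h mod d) < 2"
      using degree_mod_less[of d h] by auto
    then have "h mod d = [:coeff (h mod d) 0, coeff (h mod d) 1:]"
      by (intro poly_eqI) (auto simp: coeff_pCons coeff_eq_0 split: nat.split)
    then obtain r0 r1 where r: "h mod d = [:r0, r1:]" by blast
    have "?ev (d * (h div d) + h mod d) z = 0" using z by simp
    then have "?ev [:r0, r1:] z = 0"
      by (simp only: poly_map_of_real_mult poly_map_of_real_add d0 r) simp
    \<comment> \<open>Imaginary and real part of \<open>r0 + r1 z = 0\<close>; with \<open>b\<close>
      nonzero both coefficients vanish.\<close>
    then have "r1 * b = 0" "r0 + a * r1 = 0"
      by (simp_all add: map_poly_pCons complex_eq_iff a_def b_def algebra_simps)
    then have "h mod d = 0" using False r by simp
    then have "d dvd h" by auto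
    then show ?thesis using False by (auto simp: d_def)
  qed
qed

text \<open>Induction on the degree, splitting off one real factor at a time; lower bounds of
  composed operators multiply. A linear factor has its root outside \<open>[m, M]\<close>, so the
  form of \<open>A - r\<close> is bounded away from 0. A quadratic factor is
  \<open>(A - a)^2 + b^2 \<ge> b^2\<close>.\<close>

lemma poly_op_bounded_below:
  assumes A: "self_adjoint_op A" and lo: "\<And>x. m * (x \<bullet> x) \<le> A x \<bullet> x"
    and hi: "\<And>x. A x \<bullet> x \<le> M * (x \<bullet> x)"
    and mM: "m \<le> M" and root: "\<And>t. t \<in> {m..M} \<Longrightarrow> poly h t \<noteq> 0"
  shows "\<exists>c>0. \<forall>x. c * norm x \<le> norm (poly_op A h x)"
  using root
proof (induction "degree h" arbitrary: h rule: less_induct)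
  case less
  interpret A: bounded_linear A using A by (rule self_adjoint_opD)
  have lin: "linear A" by (rule A.linear)
  have step: "\<exists>c>0. \<forall>x. c * norm x \<le> norm (poly_op A h x)"
    if d: "d dvd h" "0 < degree d" and b: "0 < b" "\<And>x. b * norm x \<le> norm (poly_op A d x)" for d b
  proof -
    obtain q where q: "h = d * q" using d by blast
    have h0: "h \<noteq> 0" using less.prems[of m] mM by auto
    then have "degree q < degree h"
      using d by (auto simp: q degree_mult_eq)
    moreover have "poly q t \<noteq> 0" if "t \<in> {m..M}" for t
      using less.prems[OF that] by (auto simp: q)
    ultimately obtain c where c: "0 < c" "\<And>x. c * norm x \<le> norm (poly_op A q x)"
      using less.hyps by blast
    have "b * c * norm x \<le> norm (poly_op A h x)" for x
    proof -
      have "b * (c * norm x) \<le> b * norm (poly_op A q x)" using b c by simp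
      also have "\<dots> \<le> norm (poly_op A h x)" by (simp add: q poly_op_mult[OF lin] b)
      finally show ?thesis by (simp add: mult.assoc)
    qed
    then show ?thesis using b c by (intro exI[of _ "b * c"]) simp
  qed
  show ?case
  proof (cases "degree h = 0")
    case True
    then obtain k where k: "h = [:k:]" by (auto elim: degree_eq_zeroE)
    then have "k \<noteq> 0" using less.prems[of m] mM by simp
    then show ?thesis
      by (intro exI[of _ "\<bar>k\<bar>"]) (simp add: k poly_op_pCons[OF lin] poly_op_0[OF lin] A.zero)
  next
    case False
    then consider r where "[:- r, 1:] dvd h" | a b where "b \<noteq> 0" "[:a^2 + b^2, - 2 * a, 1:] dvd h"
      using real_poly_linear_or_quadratic_factor by blast
    then show ?thesis
    proof cases
      case 1
      then have "poly h r = 0" by (simp add: poly_eq_0_iff_dvd)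
      then have "r < m \<or> M < r" using less.prems[of r] by force
      then show ?thesis
      proof
        assume r: "r < m"
        have "(m - r) * norm x \<le> norm (poly_op A [:- r, 1:] x)" for x
          using lo[of x]
          by (intro norm_ge_if_inner_ge)
            (simp add: poly_op_pCons[OF lin] poly_op_0[OF lin] A.zero inner_simps algebra_simps)
        then show ?thesis using step[OF 1, of "m - r"] r by simp
      next
        assume r: "M < r"
        have "(r - M) * norm x \<le> norm (poly_op A [:- r, 1:] x)" for x
          using hi[of x]
          by (intro norm_ge_if_inner_ge)
            (simp add: poly_op_pCons[OF lin] poly_op_0[OF lin] A.zero inner_simps algebra_simps)
        then show ?thesis using step[OF 1, of "r - M"] r by simp
      qed
    next
      case 2
      have "b^2 * norm x \<le> norm (poly_op A [:a^2 + b^2, - 2 * a, 1:] x)" for x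
      proof (rule norm_ge_if_inner_ge)
        define w where "w = A x - a *\<^sub>R x"
        have "poly_op A [:a^2 + b^2, - 2 * a, 1:] x = A w - a *\<^sub>R w + b^2 *\<^sub>R x"
          by (simp add: w_def poly_op_pCons[OF lin] poly_op_0[OF lin] A.zero A.diff A.add A.scaleR
              algebra_simps power2_eq_square scaleR_2[symmetric])
        then have "poly_op A [:a^2 + b^2, - 2 * a, 1:] x \<bullet> x = w \<bullet> w + b^2 * (x \<bullet> x)"
          using self_adjoint_opD(2)[OF A, of w x] by (simp add: inner_simps w_def)
        then show "b^2 * (x \<bullet> x) \<le> \<bar>poly_op A [:a^2 + b^2, - 2 * a, 1:] x \<bullet> x\<bar>"
          using inner_ge_zero[of w] by linarith
      qed
      then show ?thesis using step[OF 2(2), of "b^2"] 2 by simp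
    qed
  qed
qed

section \<open>Laurent series of a strictly positive operator\<close>

lemma funpow_scaleR:
  fixes A :: "'a::real_vector \<Rightarrow> 'a"
  assumes "linear A"
  shows "((\<lambda>x. s *\<^sub>R A x) ^^ k) x = s ^ k *\<^sub>R (A ^^ k) x"
  by (induction k) (simp_all add: linear_scale[OF assms])

text \<open>Linearity and symmetry pass to pointwise limits; boundedness of the limit comes from the
  distance to the single operator \<open>F N\<close>.\<close>

lemma self_adjoint_op_limit:
  fixes G :: "'a::{real_inner, banach} \<Rightarrow> 'a"
  assumes F: "\<And>n. self_adjoint_op (F n)" and lim: "\<And>x. (\<lambda>n. F n x) \<longlonglongrightarrow> G x"
    and bd: "\<And>x. norm (G x - F N x) \<le> b * norm x"
  shows "self_adjoint_op G"
  unfolding self_adjoint_op_def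
proof (intro conjI allI)
  have lin: "linear (F n)" for n
    using self_adjoint_opD(1)[OF F] by (rule bounded_linear.linear)
  show "bounded_linear G"
  proof (rule bounded_linear_intro)
    show "G (x + y) = G x + G y" for x y
      using tendsto_add[OF lim[of x] lim[of y]] lim[of "x + y"]
      by (simp add: linear_add[OF lin] LIMSEQ_unique)
    show "G (r *\<^sub>R x) = r *\<^sub>R G x" for r x
      using tendsto_scaleR[OF tendsto_const lim[of x], of r] lim[of "r *\<^sub>R x"]
      by (simp add: linear_scale[OF lin] LIMSEQ_unique)
    show "norm (G x) \<le> norm x * (b + onorm (F N))" for x
    proof -
      have "norm (G x) \<le> norm (G x - F N x) + norm (F N x)"
        using norm_triangle_ineq[of "G x - F N x" "F N x"] by simp
      also have "\<dots> \<le> b * norm x + onorm (F N) * norm x"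
        by (intro add_mono bd onorm self_adjoint_opD(1) F)
      finally show ?thesis by (simp add: algebra_simps)
    qed
  qed
  show "G x \<bullet> y = x \<bullet> G y" for x y
  proof (rule LIMSEQ_unique)
    show "(\<lambda>n. F n x \<bullet> y) \<longlonglongrightarrow> G x \<bullet> y"
      by (intro tendsto_inner lim tendsto_const)
    show "(\<lambda>n. F n x \<bullet> y) \<longlonglongrightarrow> x \<bullet> G y"
      using tendsto_inner[OF tendsto_const[of x] lim[of y]] by (simp add: self_adjoint_opD(2)[OF F])
  qed
qed

text \<open>The section with exponents from \<open>-n\<close> to \<open>n - 1\<close>. Both halves
  are cut at the same \<open>n\<close>, so multiplication by \<open>A ^^ n\<close> leaves a
  polynomial in \<open>A\<close>.\<close>

definition laurent_partial ::
  "(int \<Rightarrow> real) \<Rightarrow> ('a::{real_inner, banach} \<Rightarrow> 'a) \<Rightarrow> nat \<Rightarrow> 'a \<Rightarrow> 'a" where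
  "laurent_partial c A n x = (\<Sum>k<n. c (int k) *\<^sub>R (A ^^ k) x)
    + (\<Sum>k<n. c (- int (Suc k)) *\<^sub>R (inv A ^^ Suc k) x)"

text \<open>The numbers \<open>m\<close> and \<open>M\<close> are any bounds of the form, not
  necessarily the best ones. Thus the inverse of \<open>A\<close>, with bounds \<open>1 / M\<close>
  and \<open>1 / m\<close>, and multiplication by a number in \<open>[m, M]\<close> on the real line
  are instances too.\<close>

locale spd_op =
  fixes A :: "'a::{real_inner, banach} \<Rightarrow> 'a" and m M :: real
  assumes self_adjoint: "self_adjoint_op A"
    and lower: "m * (x \<bullet> x) \<le> A x \<bullet> x"
    and upper: "A x \<bullet> x \<le> M * (x \<bullet> x)"
    and m_pos: "0 < m" and m_le_M: "m \<le> M"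
begin

sublocale A: bounded_linear A
  using self_adjoint by (rule self_adjoint_opD)

abbreviation R where "R \<equiv> inv A"

lemma M_pos: "0 < M"
  using m_pos m_le_M by simp

lemma symmetric: "A x \<bullet> y = x \<bullet> A y"
  using self_adjoint by (rule self_adjoint_opD)

lemma nonneg: "0 \<le> A x \<bullet> x"
  by (rule order_trans[OF _ lower]) (simp add: m_pos less_imp_le)

lemma norm_ge: "m * norm x \<le> norm (A x)"
  by (rule norm_ge_if_inner_ge) (rule order_trans[OF lower abs_ge_self])

text \<open>Injectivity follows from the lower bound. For surjectivity, \<open>A x = b\<close> is a
  fixed point equation for \<open>x - (A x - b) / M\<close>; the form of \<open>1 - A / M\<close>
  lies between 0 and \<open>1 - m / M\<close>, so this map is a contraction.\<close>

lemma bij: "bij A"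
proof (rule bijI)
  show "inj A"
    unfolding linear_injective_0[OF A.linear]
  proof (intro allI impI)
    fix x assume "A x = 0"
    then have "m * norm x \<le> 0" using norm_ge[of x] by simp
    then show "x = 0" using m_pos by (simp add: mult_le_0_iff)
  qed
  show "surj A"
    unfolding surj_def
  proof
    fix b
    let ?f = "\<lambda>x. x - (1 / M) *\<^sub>R (A x - b)"
    have contr: "dist (?f x) (?f y) \<le> (1 - m / M) * dist x y" for x y
    proof -
      define w where "w = x - y"
      have "norm (w - (1 / M) *\<^sub>R A w) \<le> (1 - m / M) * norm w"
      proof (rule norm_le_if_numerical_radius_le)
        show "self_adjoint_op (\<lambda>w. w - (1 / M) *\<^sub>R A w)"
          by (intro self_adjoint_op_diff self_adjoint_op_ident self_adjoint_op_scaleR self_adjoint)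
        show "\<bar>(w - (1 / M) *\<^sub>R A w) \<bullet> w\<bar> \<le> (1 - m / M) * (w \<bullet> w)" for w
          using lower[of w] upper[of w] M_pos by (simp add: inner_diff_left field_simps)
      qed
      then show ?thesis
        by (simp add: w_def dist_norm A.diff algebra_simps)
    qed
    have "\<exists>!x. ?f x = x"
      using contr m_pos m_le_M by (intro banach_fix_type[of "1 - m / M"]) auto
    then obtain x where "?f x = x" by blast
    then show "\<exists>x. b = A x" using M_pos by auto
  qed
qed

lemma A_R [simp]: "A (R x) = x"
  using bij by (simp add: bij_is_surj surj_f_inv_f)

lemma R_A [simp]: "R (A x) = x"
  using bij by (simp add: bij_is_inj)

lemma norm_R: "norm (R x) \<le> norm x / m"
  using norm_ge[of "R x"] m_pos by (simp add: field_simps)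

lemma R_self_adjoint: "self_adjoint_op R"
  unfolding self_adjoint_op_def
proof (intro conjI allI)
  show "bounded_linear R"
  proof (rule bounded_linear_intro)
    show "R (x + y) = R x + R y" for x y
      by (metis A.add A_R R_A)
    show "R (r *\<^sub>R x) = r *\<^sub>R R x" for r x
      by (metis A.scaleR A_R R_A)
    show "norm (R x) \<le> norm x * (1 / m)" for x
      using norm_R[of x] by simp
  qed
  show "R x \<bullet> y = x \<bullet> R y" for x y
    by (metis A_R symmetric)
qed

lemma R_upper: "R x \<bullet> x \<le> (1 / m) * (x \<bullet> x)"
proof -
  have "R x \<bullet> x \<le> norm (R x) * norm x"
    by (rule norm_cauchy_schwarz)
  also have "\<dots> \<le> norm x / m * norm x"
    by (intro mult_right_mono norm_R norm_ge_zero)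
  finally show ?thesis
    by (simp add: power2_norm_eq_inner[symmetric] power2_eq_square)
qed

text \<open>This is \<open>A^2 \<le> M A\<close> evaluated at \<open>R x\<close>.\<close>

lemma R_lower: "(1 / M) * (x \<bullet> x) \<le> R x \<bullet> x"
  using inner_self_le_if_le[OF self_adjoint nonneg upper M_pos, of "R x"] M_pos
  by (simp add: field_simps inner_commute)

lemma inverse_spd_op: "spd_op R (1 / M) (1 / m)"
  using R_self_adjoint R_lower R_upper m_pos m_le_M
  by unfold_locales (simp_all add: frac_le)

text \<open>Abel summation for \<open>A / M\<close>, whose form lies between 0 and 1, with
  coefficients \<open>a k * M ^ k\<close>. Scalar convergence at the end point \<open>M\<close> is
  enough.\<close>

lemma power_series:
  assumes "summable (\<lambda>k. a k * M ^ k)"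
  shows "summable (\<lambda>k. a k *\<^sub>R (A ^^ k) x)"
    and "\<lbrakk>\<And>n k. N \<le> n \<Longrightarrow> \<bar>\<Sum>i<k. a (n + i) * M ^ (n + i)\<bar> \<le> e; N \<le> n\<rbrakk>
      \<Longrightarrow> norm ((\<Sum>k. a k *\<^sub>R (A ^^ k) x) - (\<Sum>k<n. a k *\<^sub>R (A ^^ k) x)) \<le> e * norm x"
proof -
  define S where "S x = (1 / M) *\<^sub>R A x" for x
  have S: "self_adjoint_op S"
    unfolding S_def by (intro self_adjoint_op_scaleR self_adjoint)
  have S0: "0 \<le> S x \<bullet> x" "S x \<bullet> x \<le> x \<bullet> x" for x
    using nonneg[of x] upper[of x] M_pos by (simp_all add: S_def field_simps)
  have "(a k * M ^ k) *\<^sub>R (S ^^ k) x = a k *\<^sub>R (A ^^ k) x" for k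
    using M_pos unfolding S_def by (simp add: funpow_scaleR[OF A.linear] power_one_over)
  note series = Abel_operator_series[OF S S0 assms, where x = x, unfolded this]
  show "summable (\<lambda>k. a k *\<^sub>R (A ^^ k) x)"
    by (rule series(1))
  assume "\<And>n k. N \<le> n \<Longrightarrow> \<bar>\<Sum>i<k. a (n + i) * M ^ (n + i)\<bar> \<le> e" "N \<le> n"
  then show "norm ((\<Sum>k. a k *\<^sub>R (A ^^ k) x) - (\<Sum>k<n. a k *\<^sub>R (A ^^ k) x)) \<le> e * norm x"
    by (rule series(2))
qed

end

text \<open>Blocks from rank \<open>N\<close> on are small at the decisive end points:
  \<open>M\<close> for positive, \<open>m\<close> for negative exponents. No operator occurs, so one
  rank serves \<open>A\<close> and all scalars in \<open>[m, M]\<close>. The negative part has one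
  power of \<open>1 / m\<close> less, because one factor \<open>R\<close> is applied to the vector
  first.\<close>

definition laurent_rank :: "(int \<Rightarrow> real) \<Rightarrow> real \<Rightarrow> real \<Rightarrow> real \<Rightarrow> nat \<Rightarrow> bool" where
  "laurent_rank c m M e N \<longleftrightarrow> (\<forall>n\<ge>N. \<forall>k.
     \<bar>\<Sum>i<k. c (int (n + i)) * M ^ (n + i)\<bar> \<le> e \<and>
     \<bar>\<Sum>i<k. c (- int (Suc (n + i))) * (1 / m) ^ (n + i)\<bar> \<le> e)"

locale laurent_spd_op = spd_op +
  fixes c :: "int \<Rightarrow> real"
  assumes summable_pos: "summable (\<lambda>k. c (int k) * M ^ k)"
    and summable_neg: "summable (\<lambda>k. c (- int (Suc k)) * (1 / m) ^ k)"
begin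

sublocale R: spd_op R "1 / M" "1 / m"
  by (rule inverse_spd_op)

abbreviation PA where "PA \<equiv> laurent_op c A"

lemma laurent_rank_exists:
  assumes "0 < e"
  shows "\<exists>N. laurent_rank c m M e N"
proof -
  obtain N1 where "\<forall>n\<ge>N1. \<forall>k. \<bar>\<Sum>i<k. c (int (n + i)) * M ^ (n + i)\<bar> \<le> e"
    using summable_Abel_rank[OF summable_pos assms] by blast
  moreover obtain N2 where
    "\<forall>n\<ge>N2. \<forall>k. \<bar>\<Sum>i<k. c (- int (Suc (n + i))) * (1 / m) ^ (n + i)\<bar> \<le> e"
    using summable_Abel_rank[OF summable_neg assms] by blast
  ultimately show ?thesis
    unfolding laurent_rank_def by (intro exI[of _ "max N1 N2"]) auto
qed

lemma funpow_Suc_R: "(R ^^ Suc k) x = (R ^^ k) (R x)"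
  by (simp add: funpow_swap1)

text \<open>The power series estimate for \<open>A\<close> at \<open>x\<close> plus the one for
  \<open>R\<close> at \<open>R x\<close>; the latter brings in the factor
  \<open>1 / m\<close>.\<close>

lemma laurent_tail:
  assumes "laurent_rank c m M e N" "N \<le> n"
  shows "norm (PA x - laurent_partial c A n x) \<le> e * (1 + 1 / m) * norm x"
proof -
  have rank: "\<bar>\<Sum>i<k. c (int (n + i)) * M ^ (n + i)\<bar> \<le> e"
    "\<bar>\<Sum>i<k. c (- int (Suc (n + i))) * (1 / m) ^ (n + i)\<bar> \<le> e" if "N \<le> n" for n k
    using assms that unfolding laurent_rank_def by blast+
  have "0 \<le> e" using rank(1)[of N 0] by simp
  let ?p = "(\<Sum>k. c (int k) *\<^sub>R (A ^^ k) x) - (\<Sum>k<n. c (int k) *\<^sub>R (A ^^ k) x)"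
  let ?q = "(\<Sum>k. c (- int (Suc k)) *\<^sub>R (R ^^ k) (R x))
    - (\<Sum>k<n. c (- int (Suc k)) *\<^sub>R (R ^^ k) (R x))"
  have p: "norm ?p \<le> e * norm x"
    by (rule power_series(2)[OF summable_pos rank(1) assms(2)])
  have "norm ?q \<le> e * norm (R x)"
    by (rule R.power_series(2)[OF summable_neg rank(2) assms(2)])
  also have "\<dots> \<le> e * (norm x / m)"
    using norm_R \<open>0 \<le> e\<close> by (rule mult_left_mono)
  finally have q: "norm ?q \<le> e * (norm x / m)" .
  have "norm (PA x - laurent_partial c A n x) = norm (?p + ?q)"
    unfolding laurent_op_def laurent_partial_def funpow_Suc_R by (simp add: algebra_simps)
  also have "\<dots> \<le> e * norm x + e * (norm x / m)"
    using p q by (rule norm_triangle_mono)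
  finally show ?thesis by (simp add: algebra_simps)
qed

lemma laurent_limit: "(\<lambda>n. laurent_partial c A n x) \<longlonglongrightarrow> PA x"
  unfolding laurent_op_def laurent_partial_def funpow_Suc_R
  by (intro tendsto_add summable_LIMSEQ power_series(1) R.power_series(1) summable_pos summable_neg)

lemma laurent_partial_self_adjoint: "self_adjoint_op (laurent_partial c A n)"
  unfolding laurent_partial_def[abs_def]
  by (intro self_adjoint_op_add self_adjoint_op_sum self_adjoint_op_scaleR self_adjoint_op_funpow
      self_adjoint R_self_adjoint)

lemma PA_self_adjoint: "self_adjoint_op PA"
proof -
  obtain N where "laurent_rank c m M 1 N"
    using laurent_rank_exists[of 1] by auto
  then have "norm (PA x - laurent_partial c A N x) \<le> 1 * (1 + 1 / m) * norm x" for x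
    by (rule laurent_tail) simp
  then show ?thesis
    by (rule self_adjoint_op_limit[OF laurent_partial_self_adjoint laurent_limit])
qed

lemma PA_commutes: "PA (A x) = A (PA x)"
proof (rule LIMSEQ_unique)
  have AA: "(A ^^ k) (A x) = A ((A ^^ k) x)" for k
    by (rule funpow_swap1[symmetric])
  have RA: "(R ^^ k) (A x) = A ((R ^^ k) x)" for k
    by (induction k) simp_all
  have "laurent_partial c A n (A x) = A (laurent_partial c A n x)" for n
    unfolding laurent_partial_def
    by (simp only: AA RA A.add A.sum A.scaleR)
  then show "(\<lambda>n. laurent_partial c A n (A x)) \<longlonglongrightarrow> A (PA x)"
    by (simp add: A.tendsto laurent_limit)
qed (rule laurent_limit)

text \<open>The infimum \<open>l\<close> of the form is an approximate eigenvalue of the section. If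
  \<open>l < d\<close>, the section minus \<open>l\<close>, multiplied by \<open>A ^^ n\<close>,
  would be a polynomial of \<open>A\<close> without roots in \<open>[m, M]\<close>, hence bounded
  below, which is a contradiction.\<close>

lemma laurent_partial_lower:
  assumes nontriv: "\<exists>x::'a. x \<noteq> 0"
    and d: "\<And>t. t \<in> {m..M} \<Longrightarrow>
      d \<le> (\<Sum>k<n. c (int k) * t ^ k) + (\<Sum>k<n. c (- int (Suc k)) * (1 / t) ^ Suc k)"
  shows "d * (x \<bullet> x) \<le> laurent_partial c A n x \<bullet> x"
proof -
  let ?F = "laurent_partial c A n"
  define l where "l = inf_bound ?F"
  have "d \<le> l"
  proof (rule ccontr)
    assume "\<not> d \<le> l"
    \<comment> \<open>This is \<open>t^n\<close> times the scalar section minus \<open>l\<close>.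
      All exponents are shifted by \<open>n\<close>; the subtraction \<open>n - Suc k\<close> is
      exact because \<open>k < n\<close>.\<close>
    define q where "q = (\<Sum>k<n. monom (c (int k)) (n + k))
      + ((\<Sum>k<n. monom (c (- int (Suc k))) (n - Suc k)) + monom (- l) n)"
    have pow: "t ^ (n - Suc k) = t ^ n * (1 / t) ^ Suc k" if "k < n" "t \<noteq> 0" for t :: real and k
    proof -
      have "t ^ n = t ^ (n - Suc k) * t ^ Suc k" 
        using that by (simp only: power_add[symmetric]) simp
      then show ?thesis using that by (simp add: power_one_over)
    qed
    have "poly q t \<noteq> 0" if t: "t \<in> {m..M}" for t
    proof -
      have t0: "0 < t" using t m_pos by simp
      have "poly q t = t ^ n * ((\<Sum>k<n. c (int k) * t ^ k)
          + (\<Sum>k<n. c (- int (Suc k)) * (1 / t) ^ Suc k) - l)"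
        unfolding q_def
        using pow[of _ t] t0
        by (simp add: poly_sum poly_monom sum_distrib_left power_add algebra_simps)
      moreover have "0 < (\<Sum>k<n. c (int k) * t ^ k)
          + (\<Sum>k<n. c (- int (Suc k)) * (1 / t) ^ Suc k) - l"
        using d[OF t] \<open>\<not> d \<le> l\<close> by linarith
      ultimately show ?thesis using t0 by simp
    qed
    then obtain b where b: "0 < b" "\<And>x. b * norm x \<le> norm (poly_op A q x)"
      using poly_op_bounded_below[OF self_adjoint lower upper m_le_M, of q] by blast
    have opow: "(A ^^ n) ((R ^^ k) x) = (A ^^ (n - k)) x" if "k \<le> n" for k x
      using that
    proof (induction k arbitrary: n)
      case (Suc k)
      then obtain n' where "n = Suc n'" by (cases n) auto
      with Suc show ?case by (simp add: funpow_swap1[of A])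
    qed simp
    have bl: "bounded_linear (A ^^ n)"
      by (rule bounded_linear_funpow) (rule A.bounded_linear_axioms)
    then interpret An: bounded_linear "A ^^ n" .
    have q: "poly_op A q x = (A ^^ n) (?F x - l *\<^sub>R x)" for x
    proof -
      have "(\<Sum>k<n. c (- int (Suc k)) *\<^sub>R (A ^^ (n - Suc k)) x)
          = (\<Sum>k<n. c (- int (Suc k)) *\<^sub>R (A ^^ n) ((R ^^ Suc k) x))"
        by (rule sum.cong) (simp_all only: opow Suc_leI lessThan_iff)
      then show ?thesis
        unfolding q_def laurent_partial_def
        by (simp add: poly_op_add[OF A.linear] poly_op_sum[OF A.linear] poly_op_monom[OF A.linear]
            funpow_add An.add An.diff An.sum An.scaleR del: funpow.simps)
    qed
    \<comment> \<open>Adding 1 makes \<open>o'\<close> positive even if the operator norm were 0, so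
      that \<open>b / o'\<close> is a valid tolerance.\<close>
    define o' where "o' = onorm (A ^^ n) + 1"
    have o': "0 < o'" using onorm_pos_le[OF bl] by (simp add: o'_def)
    obtain x where x: "norm x = 1" "norm (?F x - l *\<^sub>R x) < b / o'"
      using inf_bound_approximate_eigenvalue[OF laurent_partial_self_adjoint nontriv, of "b / o'" n]
        b o' by (auto simp: l_def)
    have "b \<le> norm ((A ^^ n) (?F x - l *\<^sub>R x))"
      using b(2)[of x] x by (simp add: q)
    also have "\<dots> \<le> onorm (A ^^ n) * norm (?F x - l *\<^sub>R x)"
      by (rule onorm[OF bl])
    also have "\<dots> \<le> o' * norm (?F x - l *\<^sub>R x)"
      by (rule mult_right_mono) (simp_all add: o'_def)
    also have "\<dots> < b"
      using x(2) o' by (simp add: field_simps)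
    finally show False by simp
  qed
  then have "d * (x \<bullet> x) \<le> l * (x \<bullet> x)" by (rule mult_right_mono) simp
  also have "\<dots> \<le> ?F x \<bullet> x"
    unfolding l_def by (rule inf_bound_le_inner[OF self_adjoint_opD(1)[OF laurent_partial_self_adjoint]])
  finally show ?thesis .
qed

end

section \<open>The rate of one step\<close>

text \<open>All that is known of \<open>B\<close> is that it is a positive square root, bounded
  below, of an operator commuting with \<open>A\<close>. The commutator of \<open>A\<close> and
  \<open>B\<close> is shown to have norm 0.\<close>

lemma positive_sqrt_commutes:
  fixes A B :: "'a::{real_inner, banach} \<Rightarrow> 'a"
  assumes A: "bounded_linear A" and B: "positive_op B"
    and commute: "\<And>x. B (B (A x)) = A (B (B x))"
    and b: "0 < b" "\<And>x. b * norm x \<le> norm (B x)"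
  shows "A (B x) = B (A x)"
proof -
  interpret A: bounded_linear A by (rule A)
  have Bsa: "self_adjoint_op B" and B0: "0 \<le> B x \<bullet> x" for x
    using B by (auto simp: positive_op_def)
  interpret B: bounded_linear B by (rule self_adjoint_opD(1)[OF Bsa])
  \<comment> \<open>The commutator satisfies \<open>B X = - X B\<close>, hence \<open>(B + l) X = X (l - B)\<close>; for large \<open>l\<close>
     the left factor expands by more than the right one does.\<close>
  define X where "X x = A (B x) - B (A x)" for x
  have X: "bounded_linear X"
    unfolding X_def by (intro bounded_linear_sub bounded_linear_compose[of A B]
        bounded_linear_compose[of B A] A B.bounded_linear_axioms)
  interpret X: bounded_linear X by (rule X)
  have anti: "B (X x) = - X (B x)" for x
    by (simp add: X_def B.diff commute)
  define l where "l = onorm B + 1"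
  have l: "0 < l" using onorm_pos_le[OF B.bounded_linear_axioms] by (simp add: l_def)
  define k where "k = sqrt (b\<^sup>2 + l\<^sup>2)"
  have "l\<^sup>2 < b\<^sup>2 + l\<^sup>2" using b by simp
  then have lk: "l < k" unfolding k_def by (rule real_less_rsqrt)
  \<comment> \<open>From \<open>0 \<le> B \<le> l\<close> follows
    \<open>0 \<le> l - B \<le> l\<close>.\<close>
  have shrink: "norm (l *\<^sub>R x - B x) \<le> l * norm x" for x
  proof (rule norm_le_if_numerical_radius_le)
    show "self_adjoint_op (\<lambda>x. l *\<^sub>R x - B x)"
      by (intro self_adjoint_op_diff self_adjoint_op_scaleR self_adjoint_op_ident Bsa)
    fix x
    have "B x \<bullet> x \<le> norm (B x) * norm x" by (rule norm_cauchy_schwarz)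
    also have "\<dots> \<le> onorm B * norm x * norm x"
      by (intro mult_right_mono onorm B.bounded_linear_axioms norm_ge_zero)
    also have "\<dots> \<le> l * (x \<bullet> x)"
      by (simp add: l_def power2_norm_eq_inner[symmetric] power2_eq_square mult.assoc mult_right_mono)
    finally show "\<bar>(l *\<^sub>R x - B x) \<bullet> x\<bar> \<le> l * (x \<bullet> x)"
      using B0[of x] by (simp add: inner_diff_left)
  qed
  \<comment> \<open>The cross term \<open>2 l (B w, w)\<close> is nonnegative, so the squared norm
    is at least \<open>b^2 + l^2\<close> times that of \<open>w\<close>.\<close>
  have expand: "k * norm w \<le> norm (B w + l *\<^sub>R w)" for w
  proof (rule power2_le_imp_le)
    have "b\<^sup>2 * (norm w)\<^sup>2 \<le> (norm (B w))\<^sup>2"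
      using power_mono[OF b(2), of w 2] b(1) by (simp add: power_mult_distrib)
    moreover have "(norm (B w + l *\<^sub>R w))\<^sup>2 = (norm (B w))\<^sup>2 + 2 * l * (B w \<bullet> w) + l\<^sup>2 * (norm w)\<^sup>2"
      by (simp add: power2_norm_eq_inner inner_simps inner_commute power2_eq_square[of l]
          algebra_simps)
    moreover have "0 \<le> 2 * l * (B w \<bullet> w)" using B0[of w] l by simp
    ultimately show "(k * norm w)\<^sup>2 \<le> (norm (B w + l *\<^sub>R w))\<^sup>2"
      by (simp add: k_def power_mult_distrib algebra_simps)
  qed simp
  \<comment> \<open>The two estimates give \<open>k\<close> times the norm of \<open>X\<close> at
    most \<open>l\<close> times that norm, while \<open>l < k\<close>.\<close>
  have "onorm X \<le> onorm X * l / k"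
  proof (rule onorm_bound)
    show "norm (X x) \<le> onorm X * l / k * norm x" for x
    proof -
      have "k * norm (X x) \<le> norm (B (X x) + l *\<^sub>R X x)" by (rule expand)
      also have "B (X x) + l *\<^sub>R X x = X (l *\<^sub>R x - B x)"
        by (simp add: anti X.diff X.scaleR)
      also have "norm (X (l *\<^sub>R x - B x)) \<le> onorm X * norm (l *\<^sub>R x - B x)"
        by (rule onorm[OF X])
      also have "\<dots> \<le> onorm X * (l * norm x)"
        by (rule mult_left_mono[OF shrink onorm_pos_le[OF X]])
      finally show ?thesis using lk l by (simp add: field_simps)
    qed
  qed (use onorm_pos_le[OF X] l lk in simp)
  then have "onorm X * (k - l) \<le> 0" using lk l by (simp add: field_simps)
  then have "onorm X = 0" using lk onorm_pos_le[OF X] by (simp add: mult_le_0_iff)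
  then have "X x = 0" using onorm_eq_0[OF X] by simp
  then show ?thesis by (simp add: X_def)
qed

text \<open>The bounds of \<open>R\<close> at \<open>(M - A) z\<close> and \<open>(A - m) z\<close>
  add up to \<open>(A z, z) + m M (R z, z) \<le> M + m\<close>. The inequality between arithmetic
  and geometric mean then bounds the product.\<close>

lemma (in spd_op) kantorovich:
  assumes "m < M" and z: "norm z = 1"
  shows "(A z \<bullet> z) * (R z \<bullet> z) \<le> (M + m)\<^sup>2 / (4 * m * M)"
proof -
  interpret R: bounded_linear R by (rule self_adjoint_opD(1)[OF R_self_adjoint])
  have Rsym: "R x \<bullet> y = x \<bullet> R y" for x y by (rule self_adjoint_opD(2)[OF R_self_adjoint])
  define w v where "w = M *\<^sub>R z - A z" and "v = A z - m *\<^sub>R z"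
  have zz: "z \<bullet> z = 1" using z by (simp add: norm_eq_1)
  have RAz: "R z \<bullet> A z = 1" "A z \<bullet> R z = 1"
    using zz Rsym[of z "A z"] by (simp_all add: inner_commute)
  have "0 \<le> w \<bullet> w - m * (R w \<bullet> w)"
    using R_upper[of w] m_pos by (simp add: field_simps)
  moreover have "0 \<le> M * (R v \<bullet> v) - v \<bullet> v"
    using R_lower[of v] M_pos by (simp add: field_simps)
  ultimately have "0 \<le> w \<bullet> w - m * (R w \<bullet> w) + (M * (R v \<bullet> v) - v \<bullet> v)" by simp
  \<comment> \<open>This is \<open>R (A - m) (M - A)\<^sup>2 + R (M - A) (A - m)\<^sup>2 = (M - m) R (A - m) (M - A)\<close>.\<close>
  also have "\<dots> = (M - m) * ((M + m) - A z \<bullet> z - m * M * (R z \<bullet> z))"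
    by (simp add: w_def v_def R.diff R.scaleR inner_simps zz RAz inner_commute algebra_simps
        power2_eq_square)
  finally have "A z \<bullet> z + m * M * (R z \<bullet> z) \<le> M + m"
    using assms by (simp add: zero_le_mult_iff)
  moreover have nn: "0 \<le> A z \<bullet> z" "0 \<le> R z \<bullet> z"
    using nonneg[of z] R_lower[of z] M_pos zz by (auto intro: order_trans[of 0 "1/M"])
  ultimately have "(A z \<bullet> z + m * M * (R z \<bullet> z))\<^sup>2 \<le> (M + m)\<^sup>2"
    using m_pos M_pos by (intro power_mono) auto
  \<comment> \<open>The square of the sum minus the square of the difference is four times the
    product.\<close>
  moreover have "0 \<le> (A z \<bullet> z - m * M * (R z \<bullet> z))\<^sup>2" by simp
  ultimately have "4 * m * M * ((A z \<bullet> z) * (R z \<bullet> z)) \<le> (M + m)\<^sup>2"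
    by (simp add: power2_eq_square algebra_simps)
  then show ?thesis using m_pos M_pos by (simp add: field_simps)
qed

text \<open>By compactness \<open>P\<close> has a positive minimum on \<open>[m, M]\<close>. Half of
  it survives in all late sections, uniformly in \<open>t\<close>; this bound passes to the sections
  of the operator and then to their limit.\<close>

lemma (in laurent_spd_op) PA_lower:
  assumes nontriv: "\<exists>x::'a. x \<noteq> 0"
    and series: "laurent_series_on P c {m..M}" and cont: "continuous_on {m..M} P"
    and pos: "\<forall>t\<in>{m..M}. 0 < P t"
  shows "\<exists>d>0. \<forall>x. d * (x \<bullet> x) \<le> PA x \<bullet> x"
proof -
  obtain t0 where t0: "t0 \<in> {m..M}" "\<And>t. t \<in> {m..M} \<Longrightarrow> P t0 \<le> P t"
    using continuous_attains_inf[of "{m..M}" P] cont m_le_M by auto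
  define d where "d = P t0 / 2"
  have d: "0 < d" using t0 pos by (simp add: d_def)
  \<comment> \<open>Chosen so that the tail bound \<open>e * (1 + 1 / m)\<close> equals
    \<open>d\<close>, the other half of the minimum.\<close>
  define e where "e = d / (1 + 1 / m)"
  have m1: "0 < 1 + 1 / m" using m_pos by (simp add: add_pos_pos)
  have "0 < e" using d m1 by (simp add: e_def)
  then obtain N where N: "laurent_rank c m M e N" using laurent_rank_exists by blast
  have partial: "d \<le> (\<Sum>k<n. c (int k) * t ^ k) + (\<Sum>k<n. c (- int (Suc k)) * (1 / t) ^ Suc k)"
    if n: "N \<le> n" and t: "t \<in> {m..M}" for n t
  proof -
    \<comment> \<open>The tail estimate, applied to multiplication by \<open>t\<close> on the real line.\<close>
    let ?T = "\<lambda>s. t * s"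
    have t_pos: "0 < t" using t m_pos by simp
    interpret T: laurent_spd_op ?T m M c
    proof
      show "self_adjoint_op ?T"
        by (simp add: self_adjoint_op_def bounded_linear_mult_right)
      show "m * (s \<bullet> s) \<le> (t * s) \<bullet> s" "(t * s) \<bullet> s \<le> M * (s \<bullet> s)" for s :: real
        using t mult_right_mono[of m t "s * s"] mult_right_mono[of t M "s * s"]
        by (simp_all add: mult.assoc)
    qed (rule m_pos m_le_M summable_pos summable_neg)+
    have inv: "inv ?T = (\<lambda>s. s / t)"
      using t_pos by (intro inv_equality) auto
    have pow: "(?T ^^ k) 1 = t ^ k" "((\<lambda>s. s / t) ^^ k) 1 = (1 / t) ^ k" for k
      by (induction k) (simp_all add: field_simps)
    have "laurent_op c ?T 1 = P t"
      using series t t_pos unfolding laurent_op_def laurent_series_on_def inv pow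
      by (simp add: power_int_minus power_one_over power_inverse divide_inverse
          del: of_nat_Suc funpow.simps)
    moreover have "norm (laurent_op c ?T 1 - laurent_partial c ?T n 1) \<le> d"
      using T.laurent_tail[OF N n, of 1] m1 by (simp add: e_def)
    ultimately have "P t - d \<le> laurent_partial c ?T n 1" by simp
    then show ?thesis
      using t0(2)[OF t] unfolding laurent_partial_def inv pow by (simp add: d_def)
  qed
  have "d * (x \<bullet> x) \<le> PA x \<bullet> x" for x
  proof (rule LIMSEQ_le_const)
    show "(\<lambda>n. laurent_partial c A n x \<bullet> x) \<longlonglongrightarrow> PA x \<bullet> x"
      by (intro tendsto_inner laurent_limit tendsto_const)
    show "\<exists>N. \<forall>n\<ge>N. d * (x \<bullet> x) \<le> laurent_partial c A n x \<bullet> x"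
      using laurent_partial_lower[OF nontriv partial] by blast
  qed
  then show ?thesis using d by blast
qed

section \<open>One step of the algorithm in terms of the renormalised gradient\<close>

locale P_gradient_step = laurent_spd_op +
  fixes B :: "'a::{real_inner, banach} \<Rightarrow> 'a" and d :: real
  assumes B: "positive_sqrt_of B (laurent_op c A \<circ> A)"
    and d: "0 < d" "d * (x \<bullet> x) \<le> laurent_op c A x \<bullet> x"
begin

lemma BB: "B (B x) = PA (A x)"
  using B by (simp add: positive_sqrt_of_def fun_eq_iff)

lemma B_self_adjoint: "self_adjoint_op B"
  using B by (simp add: positive_sqrt_of_def positive_op_def)

lemma B_commutes: "A (B x) = B (A x)"
proof (rule positive_sqrt_commutes[where b = "d * m / (onorm B + 1)"])
  show "bounded_linear A" by (rule A.bounded_linear_axioms)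
  show "positive_op B" using B by (simp add: positive_sqrt_of_def)
  show "B (B (A x)) = A (B (B x))" for x by (simp add: BB PA_commutes)
  have bl: "bounded_linear B" by (rule self_adjoint_opD(1)[OF B_self_adjoint])
  have o: "0 < onorm B + 1" using onorm_pos_le[OF bl] by simp
  then show "0 < d * m / (onorm B + 1)" using d m_pos by simp
  \<comment> \<open>One factor \<open>B\<close> of \<open>B (B x) = PA (A x)\<close> costs at most
    its norm, so the lower bound \<open>d * m\<close> of \<open>PA (A x)\<close> is inherited by
    \<open>B x\<close>.\<close>
  show "d * m / (onorm B + 1) * norm x \<le> norm (B x)" for x
  proof -
    have "d * (m * norm x) \<le> d * norm (A x)" using norm_ge d by simp
    also have "\<dots> \<le> norm (PA (A x))"
      by (rule norm_ge_if_inner_ge) (rule order_trans[OF d(2) abs_ge_self])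
    also have "\<dots> \<le> onorm B * norm (B x)"
      unfolding BB[symmetric] by (rule onorm[OF bl])
    also have "\<dots> \<le> (onorm B + 1) * norm (B x)" by (simp add: algebra_simps)
    finally show ?thesis using o by (simp add: field_simps)
  qed
qed

lemma BR_commutes: "R (B x) = B (R x)"
  by (metis B_commutes A_R R_A)

lemma PA_A_inner: "PA (A x) \<bullet> x = B x \<bullet> B x"
  using self_adjoint_opD(2)[OF B_self_adjoint, of "B x" x] by (simp add: BB)

lemma PA_pos: "x \<noteq> 0 \<Longrightarrow> 0 < PA x \<bullet> x"
  using d(2)[of x] d(1) by (smt (verit) inner_gt_zero_iff mult_pos_pos)

lemma PA_A_pos:
  assumes "x \<noteq> 0"
  shows "0 < PA (A x) \<bullet> x"
proof -
  have "PA (A x) \<noteq> 0"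
    using PA_pos[of "A x"] norm_ge[of x] m_pos assms
    by (metis inner_zero_left less_irrefl mult_le_0_iff norm_eq_zero norm_le_zero_iff not_le)
  then have "B x \<noteq> 0"
    using BB[of x] linear_0[OF bounded_linear.linear[OF self_adjoint_opD(1)[OF B_self_adjoint]]]
    by auto
  then show ?thesis by (simp add: PA_A_inner)
qed

text \<open>The renormalised gradient as a function of the gradient instead of the point.\<close>

definition normalised :: "'a \<Rightarrow> 'a" where
  "normalised g = B g /\<^sub>R sqrt (PA (A g) \<bullet> g)"

text \<open>Since \<open>B\<close> commutes with \<open>A\<close> and \<open>R\<close>, moving one
  \<open>B\<close> across the inner product turns \<open>B T B\<close> into \<open>P(A) A T\<close>
  for \<open>T\<close> the identity, \<open>A\<close> and \<open>R\<close>.\<close>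

lemma normalised_inner:
  assumes "g \<noteq> 0"
  shows "normalised g \<bullet> normalised g = 1"
    and "A (normalised g) \<bullet> normalised g = (PA (A g) \<bullet> A g) / (PA (A g) \<bullet> g)"
    and "R (normalised g) \<bullet> normalised g = (PA g \<bullet> g) / (PA (A g) \<bullet> g)"
proof -
  define \<tau> where "\<tau> = PA (A g) \<bullet> g"
  have \<tau>: "0 < \<tau>" using PA_A_pos[OF assms] by (simp add: \<tau>_def)
  have form: "T (normalised g) \<bullet> normalised g = (T (B g) \<bullet> B g) / \<tau>"
    if "\<And>r x. T (r *\<^sub>R x) = r *\<^sub>R T x" for T :: "'a \<Rightarrow> 'a"
    using \<tau> that by (simp add: normalised_def \<tau>_def[symmetric] field_simps flip: real_sqrt_mult)
  have "normalised g \<bullet> normalised g = (B g \<bullet> B g) / \<tau>" using form[of "\<lambda>x. x"] by simp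
  then show "normalised g \<bullet> normalised g = 1"
    using \<tau> PA_A_inner[of g] by (simp add: \<tau>_def)
  have "A (B g) \<bullet> B g = B (B (A g)) \<bullet> g"
    by (simp add: B_commutes self_adjoint_opD(2)[OF B_self_adjoint])
  also have "\<dots> = PA (A g) \<bullet> A g"
    by (simp add: BB PA_commutes symmetric)
  finally show "A (normalised g) \<bullet> normalised g = (PA (A g) \<bullet> A g) / (PA (A g) \<bullet> g)"
    using form[of A] by (simp add: A.scaleR \<tau>_def)
  have "R (B g) \<bullet> B g = B (B (R g)) \<bullet> g"
    by (simp add: BR_commutes self_adjoint_opD(2)[OF B_self_adjoint])
  also have "\<dots> = PA g \<bullet> g"
    by (simp add: BB)
  finally show "R (normalised g) \<bullet> normalised g = (PA g \<bullet> g) / (PA (A g) \<bullet> g)"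
    using form[of R] by (simp add: R.A.scaleR \<tau>_def)
qed

text \<open>Along the step the form is a quadratic in \<open>s\<close> with minimum
  \<open>a0 - a1^2 / a2\<close>, attained at \<open>a1 / a2\<close>. The ratios
  \<open>a2 / a1\<close> and \<open>a0 / a1\<close> are the forms of \<open>A\<close> and
  \<open>R\<close> at the normalised gradient.\<close>

lemma rate_of_minimizing_step:
  assumes g: "g \<noteq> 0"
    and min: "\<And>s. PA (g - \<gamma> *\<^sub>R A g) \<bullet> (g - \<gamma> *\<^sub>R A g) \<le> PA (g - s *\<^sub>R A g) \<bullet> (g - s *\<^sub>R A g)"
  shows "(PA (g - \<gamma> *\<^sub>R A g) \<bullet> (g - \<gamma> *\<^sub>R A g)) / (PA g \<bullet> g)
    = 1 - 1 / ((A (normalised g) \<bullet> normalised g) * (R (normalised g) \<bullet> normalised g))"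
proof -
  interpret PA: bounded_linear PA by (rule self_adjoint_opD(1)[OF PA_self_adjoint])
  define a0 a1 a2 where "a0 = PA g \<bullet> g" and "a1 = PA (A g) \<bullet> g" and "a2 = PA (A g) \<bullet> A g"
  have Ag: "A g \<noteq> 0"
    using norm_ge[of g] m_pos g by (metis mult_le_0_iff norm_eq_zero norm_le_zero_iff not_le)
  have pos: "0 < a0" "0 < a1" "0 < a2"
    using PA_pos[OF g] PA_A_pos[OF g] PA_pos[OF Ag] by (simp_all add: a0_def a1_def a2_def)
  define \<phi> where "\<phi> s = PA (g - s *\<^sub>R A g) \<bullet> (g - s *\<^sub>R A g)" for s
  have \<phi>: "\<phi> s = a0 - 2 * s * a1 + s\<^sup>2 * a2" for s
    using self_adjoint_opD(2)[OF PA_self_adjoint, of g "A g"]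
    by (simp add: \<phi>_def a0_def a1_def a2_def PA.diff PA.scaleR inner_simps inner_commute
        power2_eq_square algebra_simps)
  have "\<phi> s = a2 * (s - a1 / a2)\<^sup>2 + (a0 - a1\<^sup>2 / a2)" for s
    using pos by (simp add: \<phi> power2_eq_square field_simps)
  moreover have "\<phi> \<gamma> \<le> \<phi> (a1 / a2)" unfolding \<phi>_def by (rule min)
  ultimately have "\<phi> \<gamma> = a0 - a1\<^sup>2 / a2"
    using pos by (smt (verit) diff_self mult_eq_0_iff mult_nonneg_nonneg power_zero_numeral
        zero_le_power2)
  then have "\<phi> \<gamma> / a0 = 1 - 1 / ((a2 / a1) * (a0 / a1))"
    using pos by (simp add: field_simps power2_eq_square)
  then show ?thesis
    by (simp add: normalised_inner[OF g] \<phi>_def a0_def a1_def a2_def)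
qed

end

section \<open>Asymptotics of the rate\<close>

lemma tendsto_mean_of_null_sequence:
  fixes f :: "nat \<Rightarrow> real"
  assumes "f \<longlonglongrightarrow> 0"
  shows "(\<lambda>n. (\<Sum>k<n. f k) / real n) \<longlonglongrightarrow> 0"
proof (rule LIMSEQ_I)
  fix e :: real assume e: "0 < e"
  obtain N where N: "\<And>n. N \<le> n \<Longrightarrow> \<bar>f n\<bar> < e / 2"
    using LIMSEQ_D[OF assms, of "e / 2"] e by auto
  define C where "C = (\<Sum>k<N. \<bar>f k\<bar>)"
  obtain N' :: nat where N': "2 * C / e < real N'" using reals_Archimedean2 by blast
  have "norm ((\<Sum>k<n. f k) / real n - 0) < e" if n: "Suc (N + N') \<le> n" for n
  proof -
    have "{..<n} = {..<N} \<union> {N..<n}" using n by auto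
    then have "(\<Sum>k<n. \<bar>f k\<bar>) = C + (\<Sum>k=N..<n. \<bar>f k\<bar>)"
      unfolding C_def by (metis finite_atLeastLessThan finite_lessThan ivl_disj_int_one(2) sum.union_disjoint)
    also have "(\<Sum>k=N..<n. \<bar>f k\<bar>) \<le> (\<Sum>k=N..<n. e / 2)"
      by (rule sum_mono) (use N in \<open>auto simp: less_imp_le\<close>)
    also have "\<dots> \<le> real n * (e / 2)"
      using e by (simp add: mult_right_mono)
    finally have "\<bar>\<Sum>k<n. f k\<bar> \<le> C + real n * (e / 2)"
      using sum_abs[of f "{..<n}"] by linarith
    moreover have "2 * C / e < real n" using N' n by linarith
    then have "C < real n * (e / 2)" using e by (simp add: field_simps)
    ultimately have "\<bar>\<Sum>k<n. f k\<bar> < real n * e" by linarith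
    then show ?thesis using n by (simp add: field_simps)
  qed
  then show "\<exists>n0. \<forall>n\<ge>n0. norm ((\<Sum>k<n. f k) / real n - 0) < e" by blast
qed

text \<open>The logarithm of the root is a Cesaro mean of \<open>ln (b (Suc k) / b k)\<close> up to
  a bounded quantity divided by \<open>n\<close>, because \<open>a n / b n\<close> stays between
  \<open>lo\<close> and \<open>hi\<close>.\<close>

lemma root_tendsto_ratio_limit:
  fixes a b :: "nat \<Rightarrow> real"
  assumes b: "\<And>n. 0 < b n" and ratio: "(\<lambda>n. b (Suc n) / b n) \<longlonglongrightarrow> L" and L: "0 < L"
    and lo: "0 < lo" and a: "\<And>n. lo * b n \<le> a n" "\<And>n. a n \<le> hi * b n"
  shows "(\<lambda>n. root n (a n / a 0)) \<longlonglongrightarrow> L"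
proof -
  have a_pos: "0 < a n" for n using a(1)[of n] b[of n] lo by (smt (verit) mult_pos_pos)
  have "(\<lambda>n. ln (b (Suc n) / b n) - ln L) \<longlonglongrightarrow> 0"
    using tendsto_diff[OF tendsto_ln[OF ratio] tendsto_const[of "ln L"]] L by simp
  then have mean: "(\<lambda>n. (\<Sum>k<n. ln (b (Suc k) / b k) - ln L) / real n) \<longlonglongrightarrow> 0"
    by (rule tendsto_mean_of_null_sequence)
  have b_ne: "b n \<noteq> 0" for n using b[of n] by simp
  have sum: "(\<Sum>k<n. ln (b (Suc k) / b k) - ln L) = ln (b n) - ln (b 0) - n * ln L" for n
    using sum_lessThan_telescope[of "\<lambda>k. ln (b k)" n] b b_ne
    by (simp add: ln_div sum_subtractf)
  define q where "q n = a n / b n" for n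
  have q: "lo \<le> q n" "q n \<le> hi" for n
    using a[of n] b[of n] by (simp_all add: q_def field_simps)
  have q_pos: "0 < q n" for n using q(1)[of n] lo by simp
  have lnq: "\<bar>ln (q n) - ln (a 0) + ln (b 0)\<bar> \<le> \<bar>ln lo\<bar> + \<bar>ln hi\<bar> + \<bar>ln (a 0)\<bar> + \<bar>ln (b 0)\<bar>" for n
  proof -
    have "ln lo \<le> ln (q n)" "ln (q n) \<le> ln hi"
      using q[of n] lo by simp_all
    then show ?thesis by linarith
  qed
  have "(\<lambda>n. (\<bar>ln lo\<bar> + \<bar>ln hi\<bar> + \<bar>ln (a 0)\<bar> + \<bar>ln (b 0)\<bar>) * (1 / real n)) \<longlonglongrightarrow> 0"
    by (intro tendsto_mult_right_zero lim_1_over_n)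
  then have "(\<lambda>n. (ln (q n) - ln (a 0) + ln (b 0)) / real n) \<longlonglongrightarrow> 0"
    by (rule Lim_null_comparison[rotated])
      (use lnq in \<open>auto intro!: always_eventually simp: divide_inverse abs_mult mult_right_mono\<close>)
  with mean have "(\<lambda>n. (\<Sum>k<n. ln (b (Suc k) / b k) - ln L) / real n
      + (ln (q n) - ln (a 0) + ln (b 0)) / real n + ln L) \<longlonglongrightarrow> 0 + 0 + ln L"
    by (intro tendsto_add tendsto_const)
  \<comment> \<open>The case \<open>n = 0\<close> is left out: there division by
    \<open>real n\<close> has the default value 0.\<close>
  moreover have "eventually (\<lambda>n. (\<Sum>k<n. ln (b (Suc k) / b k) - ln L) / real n
      + (ln (q n) - ln (a 0) + ln (b 0)) / real n + ln L = ln (a n / a 0) / real n) sequentially"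
    using eventually_gt_at_top[of 0]
  proof eventually_elim
    case (elim n)
    have "ln (q n) = ln (a n) - ln (b n)" "ln (a n / a 0) = ln (a n) - ln (a 0)"
      using a_pos[of n] b[of n] a_pos[of 0] by (simp_all add: q_def ln_div)
    moreover have "x / real n + y / real n + l = (x + y + real n * l) / real n" for x y l
      using elim by (simp add: add_divide_distrib)
    ultimately show ?case by (simp only: sum) simp
  qed
  ultimately have "(\<lambda>n. ln (a n / a 0) / real n) \<longlonglongrightarrow> ln L"
    by (simp add: tendsto_cong)
  then have "(\<lambda>n. exp (ln (a n / a 0) / real n)) \<longlonglongrightarrow> L"
    using tendsto_exp[of _ "ln L"] L by fastforce
  moreover have "eventually (\<lambda>n. exp (ln (a n / a 0) / real n) = root n (a n / a 0)) sequentially"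
    using eventually_gt_at_top[of 0]
  proof eventually_elim
    case (elim n)
    then show ?case
      using a_pos[of n] a_pos[of 0] by (simp add: root_powr_inverse powr_def field_simps)
  qed
  ultimately show ?thesis by (simp add: tendsto_cong)
qed

section \<open>Quadratic forms along approximate eigenvectors\<close>

lemma quadratic_form_of_combination:
  fixes T :: "'a::real_inner \<Rightarrow> 'a" and u v z :: "nat \<Rightarrow> 'a"
  assumes T: "linear T"
    and unit: "\<And>n. norm (u n) = 1" "\<And>n. norm (v n) = 1"
    and orth: "(\<lambda>n. u n \<bullet> v n) \<longlonglongrightarrow> 0"
    and u: "(\<lambda>n. norm (T (u n) - a *\<^sub>R u n)) \<longlonglongrightarrow> 0"
    and v: "(\<lambda>n. norm (T (v n) - b *\<^sub>R v n)) \<longlonglongrightarrow> 0"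
    and st: "\<And>n. \<bar>s n\<bar> \<le> 1" "\<And>n. \<bar>t n\<bar> \<le> 1"
    and z: "\<And>n. z n = s n *\<^sub>R u n + t n *\<^sub>R v n"
  shows "(\<lambda>n. T (z n) \<bullet> z n - ((s n)\<^sup>2 * a + (t n)\<^sup>2 * b)) \<longlonglongrightarrow> 0"
proof (rule Lim_null_comparison)
  define e f where "e n = T (u n) - a *\<^sub>R u n" and "f n = T (v n) - b *\<^sub>R v n" for n
  show "(\<lambda>n. \<bar>a + b\<bar> * \<bar>u n \<bullet> v n\<bar> + (norm (e n) * 2 + norm (f n) * 2)) \<longlonglongrightarrow> 0"
    using orth u v unfolding e_def f_def
    by (intro tendsto_add_zero tendsto_mult_right_zero tendsto_mult_left_zero tendsto_rabs_zero)
  show "\<forall>\<^sub>F n in sequentially. norm (T (z n) \<bullet> z n - ((s n)\<^sup>2 * a + (t n)\<^sup>2 * b))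
      \<le> \<bar>a + b\<bar> * \<bar>u n \<bullet> v n\<bar> + (norm (e n) * 2 + norm (f n) * 2)"
  proof (intro always_eventually allI)
    fix n
    have uu: "u n \<bullet> u n = 1" "v n \<bullet> v n = 1" using unit by (simp_all add: norm_eq_1[symmetric])
    have Tz: "T (z n) = (s n * a) *\<^sub>R u n + (t n * b) *\<^sub>R v n + (s n *\<^sub>R e n + t n *\<^sub>R f n)"
      by (simp add: z e_def f_def linear_add[OF T] linear_scale[OF T] algebra_simps)
    \<comment> \<open>The diagonal terms cancel. The rest contains either
      \<open>u n \<bullet> v n\<close> or one of the residuals \<open>e n\<close>,
      \<open>f n\<close>, with bounded coefficients.\<close>
    have "T (z n) \<bullet> z n - ((s n)\<^sup>2 * a + (t n)\<^sup>2 * b)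
        = (s n * t n) * ((a + b) * (u n \<bullet> v n)) + (s n * (e n \<bullet> z n) + t n * (f n \<bullet> z n))"
      unfolding Tz inner_add_left[of _ "s n *\<^sub>R e n + t n *\<^sub>R f n"]
      by (simp add: z inner_add_left inner_add_right uu inner_commute power2_eq_square algebra_simps)
    moreover have "norm (z n) \<le> 2"
    proof -
      have "norm (z n) \<le> \<bar>s n\<bar> * norm (u n) + \<bar>t n\<bar> * norm (v n)"
        unfolding z by (rule order_trans[OF norm_triangle_ineq]) simp
      then show ?thesis using st[of n] unit by simp
    qed
    have bound: "\<bar>r * (w \<bullet> z n)\<bar> \<le> norm w * 2" if "\<bar>r\<bar> \<le> 1" for r w
    proof -
      have "\<bar>r * (w \<bullet> z n)\<bar> \<le> 1 * (norm w * norm (z n))"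
        unfolding abs_mult by (intro mult_mono that Cauchy_Schwarz_ineq2) simp_all
      also have "\<dots> \<le> norm w * 2" using \<open>norm (z n) \<le> 2\<close> by (simp add: mult_left_mono)
      finally show ?thesis .
    qed
    have "\<bar>(s n * t n) * ((a + b) * (u n \<bullet> v n))\<bar> \<le> 1 * (\<bar>a + b\<bar> * \<bar>u n \<bullet> v n\<bar>)"
      unfolding abs_mult[of "s n * t n"] abs_mult[of "a + b"]
      using st[of n] by (intro mult_right_mono) (simp_all add: abs_mult mult_le_one)
    ultimately show "norm (T (z n) \<bullet> z n - ((s n)\<^sup>2 * a + (t n)\<^sup>2 * b))
      \<le> \<bar>a + b\<bar> * \<bar>u n \<bullet> v n\<bar> + (norm (e n) * 2 + norm (f n) * 2)"
      using bound[OF st(1)[of n], of "e n"] bound[OF st(2)[of n], of "f n"]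
      unfolding real_norm_def by linarith
  qed
qed

text \<open>As for exact eigenvectors, symmetry gives
  \<open>(b - a) (u, v) = (e, v) - (u, f)\<close>, here with the residuals on the right.\<close>

lemma approximate_eigenvectors_orthogonal:
  fixes T :: "'a::{real_inner, banach} \<Rightarrow> 'a"
  assumes T: "self_adjoint_op T" and "a \<noteq> b"
    and unit: "\<And>n. norm (u n) = 1" "\<And>n. norm (v n) = 1"
    and u: "(\<lambda>n. norm (T (u n) - a *\<^sub>R u n)) \<longlonglongrightarrow> 0"
    and v: "(\<lambda>n. norm (T (v n) - b *\<^sub>R v n)) \<longlonglongrightarrow> 0"
  shows "(\<lambda>n. u n \<bullet> v n) \<longlonglongrightarrow> 0"
proof (rule Lim_null_comparison)
  define e f where "e n = T (u n) - a *\<^sub>R u n" and "f n = T (v n) - b *\<^sub>R v n" for n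
  show "(\<lambda>n. (norm (e n) + norm (f n)) / \<bar>b - a\<bar>) \<longlonglongrightarrow> 0"
    using u v unfolding e_def f_def by (intro tendsto_divide_zero tendsto_add_zero)
  show "\<forall>\<^sub>F n in sequentially. norm (u n \<bullet> v n) \<le> (norm (e n) + norm (f n)) / \<bar>b - a\<bar>"
  proof (intro always_eventually allI)
    fix n
    have "(b - a) * (u n \<bullet> v n) = e n \<bullet> v n - u n \<bullet> f n"
      by (simp add: e_def f_def inner_simps self_adjoint_opD(2)[OF T] algebra_simps)
    moreover have "\<bar>e n \<bullet> v n\<bar> \<le> norm (e n)" "\<bar>u n \<bullet> f n\<bar> \<le> norm (f n)"
      using Cauchy_Schwarz_ineq2[of "e n" "v n"] Cauchy_Schwarz_ineq2[of "u n" "f n"] unit by simp_all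
    ultimately have "\<bar>b - a\<bar> * \<bar>u n \<bullet> v n\<bar> \<le> norm (e n) + norm (f n)"
      unfolding abs_mult[symmetric] by linarith
    then show "norm (u n \<bullet> v n) \<le> (norm (e n) + norm (f n)) / \<bar>b - a\<bar>"
      using \<open>a \<noteq> b\<close> by (simp add: field_simps)
  qed
qed

lemma (in spd_op) inverse_approximate_eigenvector:
  assumes "(\<lambda>n. norm (A (u n) - a *\<^sub>R u n)) \<longlonglongrightarrow> 0" and "a \<noteq> 0"
  shows "(\<lambda>n. norm (R (u n) - (1 / a) *\<^sub>R u n)) \<longlonglongrightarrow> 0"
proof (rule Lim_null_comparison)
  interpret R: bounded_linear R by (rule self_adjoint_opD(1)[OF R_self_adjoint])
  show "(\<lambda>n. norm (A (u n) - a *\<^sub>R u n) / (m * \<bar>a\<bar>)) \<longlonglongrightarrow> 0"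
    using assms by (intro tendsto_divide_zero)
  have "norm (R (u n) - (1 / a) *\<^sub>R u n) \<le> norm (A (u n) - a *\<^sub>R u n) / (m * \<bar>a\<bar>)" for n
  proof -
    have "R (u n) - (1 / a) *\<^sub>R u n = (- (1 / a)) *\<^sub>R R (A (u n) - a *\<^sub>R u n)"
      using \<open>a \<noteq> 0\<close> by (simp add: R.diff R.scaleR algebra_simps)
    then have "norm (R (u n) - (1 / a) *\<^sub>R u n) = norm (R (A (u n) - a *\<^sub>R u n)) / \<bar>a\<bar>"
      by (simp add: divide_inverse)
    also have "\<dots> \<le> norm (A (u n) - a *\<^sub>R u n) / m / \<bar>a\<bar>"
      by (intro divide_right_mono norm_R) simp
    finally show ?thesis by simp
  qed
  then show "\<forall>\<^sub>F n in sequentially.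
      norm (norm (R (u n) - (1 / a) *\<^sub>R u n)) \<le> norm (A (u n) - a *\<^sub>R u n) / (m * \<bar>a\<bar>)"
    by simp
qed

text \<open>Serves factors that do not converge: on the attractor \<open>x\<close> and
  \<open>y\<close> alternate with the parity of \<open>n\<close>, and only their product is
  constant.\<close>

lemma tendsto_mult_of_asymptotic_factors:
  fixes X Y x y :: "nat \<Rightarrow> real"
  assumes X: "(\<lambda>n. X n - x n) \<longlonglongrightarrow> 0" and Y: "(\<lambda>n. Y n - y n) \<longlonglongrightarrow> 0"
    and bound: "\<And>n. \<bar>x n\<bar> \<le> b" "\<And>n. \<bar>y n\<bar> \<le> b" and K: "\<And>n. x n * y n = K"
  shows "(\<lambda>n. X n * Y n) \<longlonglongrightarrow> K"
proof -
  have null: "(\<lambda>n. f n * g n) \<longlonglongrightarrow> 0" if "f \<longlonglongrightarrow> 0" "\<And>n. \<bar>g n\<bar> \<le> b" for f g :: "nat \<Rightarrow> real"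
    by (rule Lim_null_comparison[OF _ tendsto_mult_left_zero[OF tendsto_rabs_zero[OF that(1)], of b]])
      (use that(2) in \<open>auto simp: abs_mult intro!: always_eventually mult_left_mono\<close>)
  have "(\<lambda>n. (X n - x n) * (Y n - y n) + ((X n - x n) * y n + (Y n - y n) * x n) + K) \<longlonglongrightarrow> 0 * 0 + (0 + 0) + K"
    by (intro tendsto_add tendsto_mult null X Y bound tendsto_const)
  moreover have "(X n - x n) * (Y n - y n) + ((X n - x n) * y n + (Y n - y n) * x n) + K = X n * Y n" for n
    by (simp add: K[of n, symmetric] algebra_simps)
  ultimately show ?thesis by simp
qed

section \<open>The rate as a function of \<open>p\<close>\<close>

lemma asymptotic_rate_eq:
  assumes "0 < \<rho>"
  shows "asymptotic_rate \<rho> q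
    = q * (1 - q) * (\<rho> - 1)\<^sup>2 / (q * (1 - q) * (\<rho> - 1)\<^sup>2 + \<rho>)"
proof -
  have "(q + \<rho> * (1 - q)) * ((1 - q) + \<rho> * q) = q * (1 - q) * (\<rho> - 1)\<^sup>2 + \<rho>"
    by (simp add: power2_eq_square algebra_simps)
  then show ?thesis by (simp add: asymptotic_rate_def)
qed

lemma asymptotic_rate_symmetric:
  "0 < \<rho> \<Longrightarrow> asymptotic_rate \<rho> (1 - q) = asymptotic_rate \<rho> q"
  by (simp add: asymptotic_rate_eq mult.commute)

text \<open>The rate has the form \<open>w / (w + \<rho>)\<close>, increasing in \<open>w\<close>,
  and \<open>w\<close> is a positive multiple of \<open>q (1 - q)\<close>, which increases up to
  1/2.\<close>

lemma strict_mono_on_asymptotic_rate: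
  assumes "1 < \<rho>"
  shows "strict_mono_on {0..1/2} (asymptotic_rate \<rho>)"
proof (rule strict_mono_onI)
  fix r s :: real assume rs: "r \<in> {0..1/2}" "s \<in> {0..1/2}" "r < s"
  define k where "k = (\<rho> - 1)\<^sup>2"
  have k: "0 < k" using assms by (simp add: k_def)
  have "0 < (s - r) * (1 - r - s)" using rs by (intro mult_pos_pos) auto
  then have less: "r * (1 - r) * k < s * (1 - s) * k"
    using k by (intro mult_strict_right_mono) (simp_all add: algebra_simps)
  have "0 \<le> r * (1 - r) * k" using rs k by (intro mult_nonneg_nonneg) auto
  moreover have "x / (x + \<rho>) < y / (y + \<rho>)" if "0 \<le> x" "x < y" for x y
    using that assms mult_strict_right_mono[of x y \<rho>]
    by (simp add: divide_less_eq less_divide_eq algebra_simps)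
  ultimately have "r * (1 - r) * k / (r * (1 - r) * k + \<rho>) < s * (1 - s) * k / (s * (1 - s) * k + \<rho>)"
    using less by blast
  then show "asymptotic_rate \<rho> r < asymptotic_rate \<rho> s"
    using assms by (simp add: asymptotic_rate_eq k_def)
qed

lemma asymptotic_rate_half:
  "asymptotic_rate \<rho> (1/2) = ((\<rho> - 1) / (\<rho> + 1))\<^sup>2"
proof -
  have "1/2 + \<rho> * (1 - 1/2) = (\<rho> + 1) / 2" "1 - 1/2 + \<rho> * (1/2) = (\<rho> + 1) / 2"
    by (simp_all add: field_simps)
  then show ?thesis
    by (simp only: asymptotic_rate_def) (simp add: power2_eq_square)
qed

lemma asymptotic_rate_le_half:
  assumes "1 < \<rho>" and q: "q \<in> {0..1}"
  shows "asymptotic_rate \<rho> q \<le> asymptotic_rate \<rho> (1/2)"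
proof -
  have mono: "asymptotic_rate \<rho> r \<le> asymptotic_rate \<rho> (1/2)" if "r \<in> {0..1/2}" for r
    by (rule strict_mono_on_leD[OF strict_mono_on_asymptotic_rate[OF assms(1)]]) (use that in auto)
  show ?thesis
    using mono[of q] mono[of "1 - q"] asymptotic_rate_symmetric[of \<rho> q] assms by (cases "q \<le> 1/2") auto
qed

theorem mainTheorem8:
  fixes A B :: "'a::{real_inner, banach} \<Rightarrow> 'a"
    and E :: "real \<Rightarrow> 'a \<Rightarrow> 'a"
    and P :: "real \<Rightarrow> real" and c :: "int \<Rightarrow> real"
    and y :: 'a and x g z :: "nat \<Rightarrow> 'a" and \<gamma> :: "nat \<Rightarrow> real"
    and m M \<rho> p :: real
  assumes A: "positive_op A"
    and m: "m = inf_bound A" and M: "M = sup_bound A"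
    and mM: "0 < m" "m < M"
    and rho: "\<rho> = M / m"
    and P_smooth: "infinitely_differentiable_on P {m..M}"
    and P_laurent: "laurent_series_on P c {m..M}"
    and P_pos: "\<forall>a\<in>{m..M}. 0 < P a"
    and B: "positive_sqrt_of B (laurent_op c A \<circ> A)"
    and E: "spectral_family_of E A"
    and alg: "P_gradient_algorithm A (laurent_op c A) y x \<gamma>"
    and g: "\<And>k. g k = grad A y (x k)"
    and z: "\<And>k. z k = renormalised_grad A (laurent_op c A) B y (x k)"
    and z0: "\<forall>\<epsilon>. 0 < \<epsilon> \<and> \<epsilon> < (M - m) / 2 \<longrightarrow>
               E (m + \<epsilon>) (z 0) \<bullet> z 0 > 0 \<and> E (M - \<epsilon>) (z 0) \<bullet> z 0 < 1"
    and p: "0 < p" "p < 1" "attractor_number A m M z p"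
  shows "(\<forall>(W :: 'a \<Rightarrow> 'a) c' C'.
            positive_op W \<and> W \<circ> A = A \<circ> W \<and>
            c' = inf_bound W \<and> C' = sup_bound W \<and> 0 < c' \<and> c' < C' \<longrightarrow>
            (\<lambda>n. root n (\<Prod>k<n. (W (g (Suc k)) \<bullet> g (Suc k)) / (W (g k) \<bullet> g k)))
              \<longlonglongrightarrow> asymptotic_rate \<rho> p)
       \<and> (\<forall>q\<in>{0..1}. asymptotic_rate \<rho> (1 - q) = asymptotic_rate \<rho> q)
       \<and> strict_mono_on {0..1/2} (asymptotic_rate \<rho>)
       \<and> (\<forall>q\<in>{0..1}. asymptotic_rate \<rho> q \<le> asymptotic_rate \<rho> (1/2))
       \<and> asymptotic_rate \<rho> (1/2) = ((\<rho> - 1) / (\<rho> + 1))^2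
       \<and> (\<forall>k. (laurent_op c A (g (Suc k)) \<bullet> g (Suc k)) / (laurent_op c A (g k) \<bullet> g k)
                \<le> asymptotic_rate \<rho> (1/2))"
proof -
  obtain u v :: "nat \<Rightarrow> 'a" where unit: "\<And>n. norm (u n) = 1" "\<And>n. norm (v n) = 1"
    and z_even: "\<And>k. z (2*k) = sqrt p *\<^sub>R u (2*k) + sqrt (1 - p) *\<^sub>R v (2*k)"
    and z_odd: "\<And>k. z (2*k+1) = sqrt (1 - p) *\<^sub>R u (2*k+1) - sqrt p *\<^sub>R v (2*k+1)"
    and Au: "(\<lambda>n. norm (A (u n) - m *\<^sub>R u n)) \<longlonglongrightarrow> 0"
    and Av: "(\<lambda>n. norm (A (v n) - M *\<^sub>R v n)) \<longlonglongrightarrow> 0"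
    using p(3) unfolding attractor_number_def by blast
  have M0: "0 < M" using mM by simp
  have \<rho>: "1 < \<rho>" using mM by (simp add: rho)
  have saA: "self_adjoint_op A" using A by (simp add: positive_op_def)
  interpret spd_op A m M
    using saA inf_bound_le_inner[OF self_adjoint_opD(1)[OF saA]]
      inner_le_sup_bound[OF self_adjoint_opD(1)[OF saA]] mM
    by unfold_locales (simp_all add: m M)
  interpret laurent_spd_op A m M c
  proof
    show "summable (\<lambda>k. c (int k) * M ^ k)"
      using P_laurent mM by (simp add: laurent_series_on_def)
    have "summable (\<lambda>k. c (- int (Suc k)) * m powi (- int (Suc k)))"
      using P_laurent mM by (simp add: laurent_series_on_def)
    \<comment> \<open>The factor \<open>m\<close> lowers the exponent of \<open>1 / m\<close> by
      one, as the locale requires.\<close>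
    then have "summable (\<lambda>k. m * (c (- int (Suc k)) * m powi (- int (Suc k))))"
      by (rule summable_mult)
    moreover have "m * (c (- int (Suc k)) * m powi (- int (Suc k))) = c (- int (Suc k)) * (1 / m) ^ k" for k
      using mM by (simp add: power_int_minus power_one_over field_simps del: of_nat_Suc)
    ultimately show "summable (\<lambda>k. c (- int (Suc k)) * (1 / m) ^ k)"
      by (simp only:)
  qed
  have nontriv: "\<exists>x::'a. x \<noteq> 0"
  proof
    show "u 0 \<noteq> 0" using unit(1)[of 0] by auto
  qed
  have "continuous_on {m..M} P"
  proof -
    obtain D :: "nat \<Rightarrow> real \<Rightarrow> real" where D: "\<forall>a\<in>{m..M}. D 0 a = P a"
      "\<forall>n. \<forall>a\<in>{m..M}. (D n has_real_derivative D (Suc n) a) (at a within {m..M})"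
      using P_smooth unfolding infinitely_differentiable_on_def by blast
    have "continuous_on {m..M} (D 0)"
      unfolding continuous_on_eq_continuous_within using D(2) by (blast intro: DERIV_continuous)
    then show ?thesis using D(1) continuous_on_cong[of "{m..M}" "{m..M}" "D 0" P] by blast
  qed
  then obtain d where "0 < d" "\<And>x. d * (x \<bullet> x) \<le> PA x \<bullet> x"
    using PA_lower[OF nontriv P_laurent _ P_pos] by blast
  then interpret P_gradient_step A m M c B d
    using B by unfold_locales

  \<comment> \<open>Recursion of the gradients\<close>
  have grad_step: "grad A y (x k - s *\<^sub>R grad A y (x k)) = g k - s *\<^sub>R A (g k)" for k s
    by (simp add: g grad_def A.diff A.scaleR)
  have g_Suc: "g (Suc k) = g k - \<gamma> k *\<^sub>R A (g k)" for k
    using alg grad_step[of k "\<gamma> k"] g[of "Suc k"] g[of k]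
    by (simp add: P_gradient_algorithm_def)
  have min: "PA (g k - \<gamma> k *\<^sub>R A (g k)) \<bullet> (g k - \<gamma> k *\<^sub>R A (g k))
      \<le> PA (g k - s *\<^sub>R A (g k)) \<bullet> (g k - s *\<^sub>R A (g k))" for k s
    using alg unfolding P_gradient_algorithm_def is_arg_min_def grad_step by (meson not_le)
  have z_normalised: "z k = normalised (g k)" for k
    by (simp add: z renormalised_grad_def normalised_def g)

  \<comment> \<open>Both parities in one formula; the minus sign of the odd steps goes into
    \<open>t\<close>.\<close>
  define s where "s n = (if even n then sqrt p else sqrt (1 - p))" for n :: nat
  define t where "t n = (if even n then sqrt (1 - p) else - sqrt p)" for n :: nat
  have z_comb: "z n = s n *\<^sub>R u n + t n *\<^sub>R v n" for n
  proof (cases "even n")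
    case True
    then obtain k where "n = 2 * k" by (rule evenE)
    with z_even[of k] show ?thesis by (simp add: s_def t_def)
  next
    case False
    then obtain k where "n = 2 * k + 1" by (rule oddE)
    with z_odd[of k] show ?thesis by (simp add: s_def t_def)
  qed
  have st_sq: "(s n)\<^sup>2 = (if even n then p else 1 - p)" "(t n)\<^sup>2 = (if even n then 1 - p else p)" for n
    using p by (simp_all add: s_def t_def)
  have st: "\<bar>s n\<bar> \<le> 1" "\<bar>t n\<bar> \<le> 1" for n
    using p by (simp_all add: s_def t_def)
  have orth: "(\<lambda>n. u n \<bullet> v n) \<longlonglongrightarrow> 0"
    using mM by (intro approximate_eigenvectors_orthogonal[OF saA _ unit Au Av]) simp
  note form = quadratic_form_of_combination[OF _ unit orth _ _ st z_comb]

  \<comment> \<open>A vanishing gradient stays zero, which contradicts \<open>(z\<^sub>n, z\<^sub>n) \<longlonglongrightarrow> 1\<close> on the attractor.\<close>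
  have g_nz: "g k \<noteq> 0" for k
  proof
    assume k: "g k = 0"
    have "g (k + j) = 0" for j
      by (induction j) (simp_all add: k g_Suc A.zero)
    then have "z (k + j) = 0" for j
      using self_adjoint_opD(1)[OF B_self_adjoint]
      by (simp add: z_normalised normalised_def bounded_linear.linear linear_0)
    moreover have "(\<lambda>n. z n \<bullet> z n - ((s n)\<^sup>2 * 1 + (t n)\<^sup>2 * 1)) \<longlonglongrightarrow> 0"
      by (rule form[of "\<lambda>x. x"]) (simp_all add: linear_id[unfolded id_def])
    then have "(\<lambda>j. z (j + k) \<bullet> z (j + k) - ((s (j + k))\<^sup>2 + (t (j + k))\<^sup>2)) \<longlonglongrightarrow> 0"
      using LIMSEQ_ignore_initial_segment by fastforce
    moreover have "(s n)\<^sup>2 + (t n)\<^sup>2 = 1" for n by (simp add: st_sq)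
    ultimately have "(\<lambda>j::nat. - 1::real) \<longlonglongrightarrow> 0" by (simp add: add.commute)
    then show False by (simp add: LIMSEQ_const_iff)
  qed

  \<comment> \<open>Rates of single steps\<close>
  define X Y where "X n = A (z n) \<bullet> z n" and "Y n = R (z n) \<bullet> z n" for n
  have rate: "(PA (g (Suc k)) \<bullet> g (Suc k)) / (PA (g k) \<bullet> g k) = 1 - 1 / (X k * Y k)" for k
    unfolding g_Suc X_def Y_def z_normalised by (rule rate_of_minimizing_step[OF g_nz min])

  have rate_le: "(PA (g (Suc k)) \<bullet> g (Suc k)) / (PA (g k) \<bullet> g k) \<le> asymptotic_rate \<rho> (1/2)" for k
  proof -
    have "norm (z k) = 1"
      using normalised_inner(1)[OF g_nz[of k]] by (simp add: z_normalised norm_eq_1)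
    then have le: "X k * Y k \<le> (M + m)\<^sup>2 / (4 * m * M)"
      unfolding X_def Y_def by (rule kantorovich[OF mM(2)])
    have "0 < X k * Y k"
      using normalised_inner(2,3)[OF g_nz[of k]] PA_pos[OF g_nz[of k]] PA_A_pos[OF g_nz[of k]]
        PA_pos[of "A (g k)"] PA_A_pos[of "A (g k)"] norm_ge[of "g k"] g_nz[of k] mM
      by (cases "A (g k) = 0") (simp_all add: X_def Y_def z_normalised mult_le_0_iff)
    then have "1 / ((M + m)\<^sup>2 / (4 * m * M)) \<le> 1 / (X k * Y k)"
      using le by (intro frac_le) simp_all
    moreover have "1 - 1 / ((M + m)\<^sup>2 / (4 * m * M)) = ((\<rho> - 1) / (\<rho> + 1))\<^sup>2"
    proof -
      have "\<rho> - 1 = (M - m) / m" "\<rho> + 1 = (M + m) / m"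
        using mM by (simp_all add: rho diff_divide_distrib add_divide_distrib)
      then have "(\<rho> - 1) / (\<rho> + 1) = (M - m) / (M + m)"
        using mM by simp
      moreover have "1 - 1 / ((M + m)\<^sup>2 / (4 * m * M)) = ((M + m)\<^sup>2 - 4 * m * M) / (M + m)\<^sup>2"
        using mM by (simp add: diff_divide_distrib)
      moreover have "(M + m)\<^sup>2 - 4 * m * M = (M - m)\<^sup>2"
        by (simp add: power2_eq_square algebra_simps)
      ultimately show ?thesis by (simp add: power_divide)
    qed
    ultimately show ?thesis unfolding rate asymptotic_rate_half by linarith
  qed

  \<comment> \<open>The value of the product for even \<open>n\<close>. Odd \<open>n\<close>
    exchange \<open>p\<close> and \<open>1 - p\<close>, which changes both factors but not their
    product.\<close>
  define K where "K = (p * m + (1 - p) * M) * (p * (1 / m) + (1 - p) * (1 / M))"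
  have XY: "(\<lambda>n. X n * Y n) \<longlonglongrightarrow> K"
  proof (rule tendsto_mult_of_asymptotic_factors)
    show "(\<lambda>n. X n - ((s n)\<^sup>2 * m + (t n)\<^sup>2 * M)) \<longlonglongrightarrow> 0"
      unfolding X_def by (rule form[OF A.linear Au Av])
    show "(\<lambda>n. Y n - ((s n)\<^sup>2 * (1 / m) + (t n)\<^sup>2 * (1 / M))) \<longlonglongrightarrow> 0"
      unfolding Y_def using mM
      by (intro form R.A.linear inverse_approximate_eigenvector Au Av) simp_all
    show "((s n)\<^sup>2 * m + (t n)\<^sup>2 * M) * ((s n)\<^sup>2 * (1 / m) + (t n)\<^sup>2 * (1 / M)) = K" for n
      using mM by (simp add: st_sq K_def field_simps)
    have comb: "\<bar>(s n)\<^sup>2 * a + (t n)\<^sup>2 * b\<bar> \<le> a + b" if "0 < a" "0 < b" for n a b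
    proof -
      have "(s n)\<^sup>2 * a \<le> 1 * a" "(t n)\<^sup>2 * b \<le> 1 * b"
        using that p by (intro mult_right_mono; simp add: st_sq)+
      moreover have "0 \<le> (s n)\<^sup>2 * a" "0 \<le> (t n)\<^sup>2 * b" using that by simp_all
      ultimately show ?thesis by linarith
    qed
    have "0 < 1 / m" "0 < 1 / M" using mM by simp_all
    then show "\<bar>(s n)\<^sup>2 * m + (t n)\<^sup>2 * M\<bar> \<le> m + M + (1 / m + 1 / M)"
      "\<bar>(s n)\<^sup>2 * (1 / m) + (t n)\<^sup>2 * (1 / M)\<bar> \<le> m + M + (1 / m + 1 / M)" for n
      using comb[of m M n] comb[of "1 / m" "1 / M" n] mM M0 by linarith+
  qed
  define w where "w = p * (1 - p) * (\<rho> - 1)\<^sup>2"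
  have w: "0 < w" using p \<rho> by (simp add: w_def)
  have M\<rho>: "M = \<rho> * m" using mM by (simp add: rho)
  \<comment> \<open>Expanding gives \<open>K = 1 + w / \<rho>\<close>, so \<open>1 - 1 / K\<close>
    is the rate in the form \<open>w / (w + \<rho>)\<close>.\<close>
  have K: "K = (w + \<rho>) / \<rho>"
    using mM \<rho> unfolding K_def M\<rho> w_def
    by (simp add: power2_eq_square field_simps)
  have rate_p: "asymptotic_rate \<rho> p = w / (w + \<rho>)"
    unfolding w_def using \<rho> by (intro asymptotic_rate_eq) simp
  then have L_pos: "0 < asymptotic_rate \<rho> p"
    using w \<rho> by simp
  have "1 - 1 / K = asymptotic_rate \<rho> p"
    using w \<rho> unfolding rate_p K by (simp add: field_simps)
  moreover have "K \<noteq> 0" using w \<rho> by (simp add: K)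
  ultimately have ratio: "(\<lambda>k. (PA (g (Suc k)) \<bullet> g (Suc k)) / (PA (g k) \<bullet> g k)) \<longlonglongrightarrow> asymptotic_rate \<rho> p"
    unfolding rate using tendsto_diff[OF tendsto_const tendsto_divide[OF tendsto_const XY], of 1 1]
    by simp

  \<comment> \<open>Rates measured with \<open>W\<close>\<close>
  have "(\<lambda>n. root n (\<Prod>k<n. (W (g (Suc k)) \<bullet> g (Suc k)) / (W (g k) \<bullet> g k)))
      \<longlonglongrightarrow> asymptotic_rate \<rho> p"
    if W: "positive_op W" and c': "0 < inf_bound W" for W :: "'a \<Rightarrow> 'a"
  proof -
    have blW: "bounded_linear W" using W by (simp add: positive_op_def self_adjoint_op_def)
    have blP: "bounded_linear PA" by (rule self_adjoint_opD(1)[OF PA_self_adjoint])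
    have W_pos: "0 < W (g k) \<bullet> g k" for k
    proof -
      have "0 < inf_bound W * (g k \<bullet> g k)" using c' g_nz[of k] by simp
      then show ?thesis using inf_bound_le_inner[OF blW, of "g k"] by linarith
    qed
    have tele: "(\<Prod>k<n. (W (g (Suc k)) \<bullet> g (Suc k)) / (W (g k) \<bullet> g k))
        = (W (g n) \<bullet> g n) / (W (g 0) \<bullet> g 0)" for n
    proof (induction n)
      case 0
      then show ?case using W_pos[of 0] by simp
    next
      case (Suc n)
      then show ?case using W_pos[of n] by simp
    qed
    \<comment> \<open>A positive upper bound of \<open>P(A)\<close>. With the lower bound
      \<open>d\<close> it makes the forms of \<open>W\<close> and \<open>P(A)\<close> comparable,
      and the constants disappear under the root.\<close>
    define h where "h = \<bar>sup_bound PA\<bar> + 1"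
    have h: "0 < h" by (simp add: h_def add_nonneg_pos)
    have h_le: "PA x \<bullet> x \<le> h * (x \<bullet> x)" for x
      by (rule order_trans[OF inner_le_sup_bound[OF blP]]) (auto simp: h_def intro: mult_right_mono)
    show ?thesis
      unfolding tele
    proof (rule root_tendsto_ratio_limit[OF _ ratio L_pos])
      show "0 < PA (g n) \<bullet> g n" for n by (rule PA_pos[OF g_nz])
      show "0 < inf_bound W / h" using c' h by simp
      show "inf_bound W / h * (PA (g n) \<bullet> g n) \<le> W (g n) \<bullet> g n" for n
      proof -
        have "inf_bound W / h * (PA (g n) \<bullet> g n) \<le> inf_bound W / h * (h * (g n \<bullet> g n))"
          using h_le c' h by (intro mult_left_mono) auto
        also have "\<dots> \<le> W (g n) \<bullet> g n"
          using inf_bound_le_inner[OF blW, of "g n"] h by simp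
        finally show ?thesis .
      qed
      show "W (g n) \<bullet> g n \<le> \<bar>sup_bound W\<bar> / d * (PA (g n) \<bullet> g n)" for n
      proof -
        have "W (g n) \<bullet> g n \<le> sup_bound W * (g n \<bullet> g n)"
          by (rule inner_le_sup_bound[OF blW])
        also have "\<dots> \<le> \<bar>sup_bound W\<bar> * (g n \<bullet> g n)"
          by (intro mult_right_mono) simp_all
        also have "\<dots> = \<bar>sup_bound W\<bar> / d * (d * (g n \<bullet> g n))"
          using d(1) by simp
        also have "\<dots> \<le> \<bar>sup_bound W\<bar> / d * (PA (g n) \<bullet> g n)"
          using d by (intro mult_left_mono) auto
        finally show ?thesis .
      qed
    qed
  qed
  then show ?thesis
    using rate_le \<rho> asymptotic_rate_symmetric[of \<rho>] strict_mono_on_asymptotic_rate[of \<rho>]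
      asymptotic_rate_le_half[of \<rho>] asymptotic_rate_half[of \<rho>] by auto
qed

end
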